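(* Suppose $U_1=(u_1,E_1)^T$ is the solution to the Cauchy problem $$\partial_tu_1-\gamma\partial_{xx}E_1+E_1+u_1=0,\qquad \partial_tE_1-u_1=0,\qquad (u_1,E_1)(0,x)=(u_{10},E_{10})(x),\quad x\in\mathbb{R}.$$ Then, for any integer $\alpha\ge0$, there is a positive constant $C$ such that for all $t\ge 0$ $$\|\partial_x^\alpha u_1(t)\|_{L^2}\le Ce^{-\frac t2}\|(\partial_x^\alpha u_{10},\partial_x^\alpha E_{10},\partial_x^{\alpha+1}E_{10})\|_{L^2},$$ $$\|\partial_x^\alpha E_1(t)\|_{L^2}\le Ce^{-\frac t2}\|(\partial_x^{(\alpha-1)_+}u_{10},\partial_x^\alpha E_{10})\|_{L^2}.$$
   Context: $\gamma>0$ is a constant ($\gamma=P'(1)$). $(\alpha-1)_+=\max\{0,\alpha-1\}$. The initial data are such that the norms on the right-hand sides are finite; norms are over $\mathbb{R}$ in $x$. *)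

theory Defs
  imports "HOL-Analysis.Analysis"
begin

definition test_function :: "(real \<Rightarrow> real) \<Rightarrow> bool" where
  "test_function \<phi> \<longleftrightarrow>
     (\<forall>n x. (deriv ^^ n) \<phi> field_differentiable (at x)) \<and>
     (\<exists>K. compact K \<and> (\<forall>x. x \<notin> K \<longrightarrow> \<phi> x = 0))"

definition locally_integrable :: "(real \<Rightarrow> real) \<Rightarrow> bool" where
  "locally_integrable f \<longleftrightarrow> (\<forall>K. compact K \<longrightarrow> set_integrable lebesgue K f)"

definition has_weak_deriv :: "nat \<Rightarrow> (real \<Rightarrow> real) \<Rightarrow> (real \<Rightarrow> real) \<Rightarrow> bool" where
  "has_weak_deriv n f g \<longleftrightarrow> locally_integrable f \<and> locally_integrable g \<and>
     (\<forall>\<phi>. test_function \<phi> \<longrightarrow>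
        (LINT x|lebesgue. f x * (deriv ^^ n) \<phi> x) = (-1) ^ n * (LINT x|lebesgue. g x * \<phi> x))"

(* A representative of the n-th weak derivative, which is unique up to null sets;
   unspecified when f has none, so it is only used together with deriv_in_L2. *)
definition weak_deriv :: "nat \<Rightarrow> (real \<Rightarrow> real) \<Rightarrow> real \<Rightarrow> real" where
  "weak_deriv n f = (SOME g. has_weak_deriv n f g)"

definition in_L2 :: "(real \<Rightarrow> real) \<Rightarrow> bool" where
  "in_L2 f \<longleftrightarrow> f \<in> borel_measurable lebesgue \<and> integrable lebesgue (\<lambda>x. (f x)\<^sup>2)"

definition deriv_in_L2 :: "nat \<Rightarrow> (real \<Rightarrow> real) \<Rightarrow> bool" where
  "deriv_in_L2 n f \<longleftrightarrow> (\<exists>g. has_weak_deriv n f g \<and> in_L2 g)"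

(* Polymorphic in the codomain so that it also covers tuples of functions: the norm of a
   product type is Euclidean, e.g. (norm (a, b, c))\<^sup>2 = a\<^sup>2 + b\<^sup>2 + c\<^sup>2 for reals. *)
definition L2_norm :: "(real \<Rightarrow> 'b::real_normed_vector) \<Rightarrow> real" where
  "L2_norm f = sqrt (LINT x|lebesgue. (norm (f x))\<^sup>2)"

(* Continuity of t \<mapsto> w t from [0,\<infinity>) into the locally integrable functions of x. *)
definition continuous_into_L1_loc :: "(real \<Rightarrow> real \<Rightarrow> real) \<Rightarrow> bool" where
  "continuous_into_L1_loc w \<longleftrightarrow>
     (\<forall>t\<ge>0. locally_integrable (w t)) \<and>
     (\<forall>K. compact K \<longrightarrow> (\<forall>t\<ge>0.
        ((\<lambda>s. LINT x:K|lebesgue. \<bar>w s x - w t x\<bar>) \<longlongrightarrow> 0) (at t within {0..})))"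

(* (u, E) solves u_t - \<gamma> E_xx + E + u = 0, E_t - u = 0 on [0,\<infinity>) \<times> R with data (u0, E0).
   The equations hold in the sense of distributions: for functions continuous in time with
   values in L^1_loc this is the same as testing in x only and differentiating the pairing
   in t (one-sidedly at t = 0).  No decay in x is assumed; it is not needed for uniqueness,
   because of the finite speed of propagation. *)
definition solves_cauchy ::
  "real \<Rightarrow> (real \<Rightarrow> real \<Rightarrow> real) \<Rightarrow> (real \<Rightarrow> real \<Rightarrow> real) \<Rightarrow>
   (real \<Rightarrow> real) \<Rightarrow> (real \<Rightarrow> real) \<Rightarrow> bool" where
  "solves_cauchy \<gamma> u E u0 E0 \<longleftrightarrow>
     continuous_into_L1_loc u \<and> continuous_into_L1_loc E \<and>
     (\<forall>\<phi>. test_function \<phi> \<longrightarrow> (\<forall>t\<ge>0.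
        ((\<lambda>s. LINT x|lebesgue. u s x * \<phi> x) has_real_derivative
           \<gamma> * (LINT x|lebesgue. E t x * (deriv ^^ 2) \<phi> x)
           - (LINT x|lebesgue. E t x * \<phi> x) - (LINT x|lebesgue. u t x * \<phi> x))
          (at t within {0..}) \<and>
        ((\<lambda>s. LINT x|lebesgue. E s x * \<phi> x) has_real_derivative
           (LINT x|lebesgue. u t x * \<phi> x)) (at t within {0..}))) \<and>
     (AE x in lebesgue. u 0 x = u0 x) \<and> (AE x in lebesgue. E 0 x = E0 x)"

end

theory Submission
  imports Defs "HOL-Real_Asymp.Real_Asymp"
begin

text \<open>
  Eliminating \<open>u\<close> gives the damped Klein-Gordon equation \<open>E\<^sub>t\<^sub>t + E\<^sub>t + E = \<gamma> E\<^sub>x\<^sub>x\<close>, and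
  \<open>F = exp (t/2) E\<close> turns it into the undamped equation \<open>F\<^sub>t\<^sub>t = \<gamma> F\<^sub>x\<^sub>x - 3/4 F\<close>, whose energy
  \<open>\<integral> F\<^sub>t\<^sup>2 + \<gamma> F\<^sub>x\<^sup>2 + 3/4 F\<^sup>2\<close> is conserved; this is the source of the rate \<open>exp (- t/2)\<close>.
  The given solution is only locally integrable in \<open>x\<close>, lower derivatives of the data may fail to be
  square integrable, and the second estimate lies one derivative below the energy. Conservation of
  energy is therefore used for smooth solutions of the dual problem only.

  For a test function \<open>\<phi>\<close>, let \<open>S(t) \<phi>\<close> be the solution of the undamped equation with the data
  \<open>0\<close> and \<open>\<phi>\<close>, and \<open>C(t) \<phi>\<close> its time derivative. In one space dimension \<open>S(t) \<phi>\<close> is an explicit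
  average of translates of \<open>\<phi>\<close> against a Bessel function, so that both are test functions
  again. Energy conservation for \<open>S(t) \<phi>\<close> bounds \<open>C(t) \<phi>\<close>, \<open>\<partial>\<^sub>x S(t) \<phi>\<close> and \<open>S(t) \<phi>\<close> in \<open>L\<^sup>2\<close> by
  \<open>\<phi>\<close> (lemma \<open>propagator_bounds\<close>). Differentiating a pairing of the solution at time \<open>s\<close> with the
  propagators at time \<open>t - s\<close> shows that it does not depend on \<open>s\<close>, whence
  \<open>exp (t/2) \<langle>E(t), \<phi>\<rangle> = \<langle>E\<^sub>0, C(t) \<phi> + 1/2 S(t) \<phi>\<rangle> + \<langle>u\<^sub>0, S(t) \<phi>\<rangle>\<close>
  (lemma \<open>solution_at_time_by_duality\<close>); the \<open>t\<close>-derivative of this identity is the corresponding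
  formula for \<open>u\<close>. Replacing \<open>\<phi>\<close> by its \<open>\<alpha>\<close>-th derivative, which commutes with the propagators,
  the derivatives can be moved to the data, except that one of them stays on the propagator when
  \<open>\<partial>\<^sup>\<alpha>\<^sup>-\<^sup>1 u\<^sub>0\<close> or \<open>\<partial>\<^sup>\<alpha>\<^sup>+\<^sup>1 E\<^sub>0\<close> is what is given. Thus
  \<open>\<phi> \<mapsto> \<langle>E(t), \<partial>\<^sup>\<alpha> \<phi>\<rangle>\<close> is bounded in \<open>L\<^sup>2\<close> by \<open>exp (- t/2)\<close> times the norm of the data, likewise for \<open>u\<close>, and the Riesz
  representation theorem (lemma \<open>Riesz_test_functions\<close>) yields the weak derivative together
  with its bound. The fundamental lemma of the calculus of variations transfers the bound to the
  representative that \<^const>\<open>weak_deriv\<close> selects.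
\<close>

section \<open>Smooth functions and test functions\<close>

text \<open>Finite orders of differentiability are needed as an intermediate notion because closure under
  products is proved by induction on the order: the derivative of a product is a sum of products
  with one order less.\<close>

fun times_differentiable :: "nat \<Rightarrow> (real \<Rightarrow> real) \<Rightarrow> bool" where
  "times_differentiable 0 f \<longleftrightarrow> True"
| "times_differentiable (Suc n) f \<longleftrightarrow>
     (\<forall>x. f field_differentiable (at x)) \<and> times_differentiable n (deriv f)"

lemma times_differentiable_iff:
  "times_differentiable n f \<longleftrightarrow> (\<forall>k<n. \<forall>x. (deriv ^^ k) f field_differentiable (at x))"
proof (induction n arbitrary: f)
  case (Suc n)
  have "(\<forall>k<Suc n. P k) \<longleftrightarrow> P 0 \<and> (\<forall>k<n. P (Suc k))" for P
    using less_Suc_eq_0_disj by auto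
  then show ?case
    using Suc by (simp add: funpow_Suc_right del: funpow.simps(2))
qed auto

lemma times_differentiable_antimono:
  "times_differentiable n f \<Longrightarrow> m \<le> n \<Longrightarrow> times_differentiable m f"
  by (auto simp: times_differentiable_iff)

lemma deriv_ext:
  assumes "\<And>x. (f has_real_derivative f' x) (at x)"
  shows "deriv f = f'"
  using assms DERIV_imp_deriv by blast

lemma times_differentiable_SucI:
  assumes "\<And>x. (f has_real_derivative f' x) (at x)" "times_differentiable n f'"
  shows "times_differentiable (Suc n) f"
  using assms deriv_ext[OF assms(1)] by (auto simp: field_differentiable_def)

lemma times_differentiable_add:
  "times_differentiable n f \<Longrightarrow> times_differentiable n g \<Longrightarrow>
   times_differentiable n (\<lambda>x. f x + g x)"
proof (induction n arbitrary: f g)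
  case (Suc n)
  then show ?case
    by (intro times_differentiable_SucI[where f' = "\<lambda>x. deriv f x + deriv g x"])
       (auto intro!: derivative_eq_intros simp: field_differentiable_derivI)
qed auto

lemma times_differentiable_mult:
  "times_differentiable n f \<Longrightarrow> times_differentiable n g \<Longrightarrow>
   times_differentiable n (\<lambda>x. f x * g x)"
proof (induction n arbitrary: f g)
  case (Suc n)
  have "times_differentiable n f" "times_differentiable n g"
    using Suc.prems times_differentiable_antimono le_SucI order_refl by blast+
  with Suc.prems Suc.IH have "times_differentiable n (\<lambda>x. f x * deriv g x + deriv f x * g x)"
    by (intro times_differentiable_add) auto
  moreover have "((\<lambda>x. f x * g x) has_real_derivative f x * deriv g x + deriv f x * g x) (at x)" for x
    using Suc.prems by (intro DERIV_mult') (auto simp: field_differentiable_derivI)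
  ultimately show ?case
    by (intro times_differentiable_SucI)
qed auto

lemma times_differentiable_affine:
  "times_differentiable n f \<Longrightarrow> times_differentiable n (\<lambda>x. f (a * x + b))"
proof (induction n arbitrary: f)
  case (Suc n)
  have "((\<lambda>x. f (a * x + b)) has_real_derivative a * deriv f (a * x + b)) (at x)" for x
  proof -
    have "((\<lambda>x. a * x + b) has_real_derivative a) (at x)"
      by (auto intro!: derivative_eq_intros)
    then show ?thesis
      using Suc.prems DERIV_chain2[of f "deriv f (a * x + b)" "\<lambda>x. a * x + b" x a]
      by (simp add: field_differentiable_derivI mult.commute)
  qed
  moreover have "times_differentiable m (\<lambda>x. a)" for m
  proof -
    have "(deriv ^^ k) (\<lambda>x. a) = (\<lambda>x. if k = 0 then a else 0)" for k
      by (induction k) auto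
    then show ?thesis by (auto simp: times_differentiable_iff)
  qed
  ultimately show ?case
    using Suc by (intro times_differentiable_SucI) (auto intro: times_differentiable_mult)
qed auto

lemma test_function_iff:
  "test_function \<phi> \<longleftrightarrow>
     (\<forall>n. times_differentiable n \<phi>) \<and> (\<exists>R>0. \<forall>x. \<bar>x\<bar> > R \<longrightarrow> \<phi> x = 0)"
proof -
  have "(\<exists>K. compact K \<and> (\<forall>x. x \<notin> K \<longrightarrow> \<phi> x = 0)) \<longleftrightarrow> (\<exists>R>0. \<forall>x. \<bar>x\<bar> > R \<longrightarrow> \<phi> x = 0)"
  proof
    assume "\<exists>K. compact K \<and> (\<forall>x. x \<notin> K \<longrightarrow> \<phi> x = 0)"
    then obtain K where K: "compact K" "\<And>x. x \<notin> K \<Longrightarrow> \<phi> x = 0" by auto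
    from compact_imp_bounded[OF K(1)] obtain R where "R > 0" "\<And>x. x \<in> K \<Longrightarrow> \<bar>x\<bar> \<le> R"
      unfolding bounded_pos real_norm_def by blast
    then show "\<exists>R>0. \<forall>x. \<bar>x\<bar> > R \<longrightarrow> \<phi> x = 0" using K(2) by force
  next
    assume "\<exists>R>0. \<forall>x. \<bar>x\<bar> > R \<longrightarrow> \<phi> x = 0"
    then obtain R where "\<forall>x. \<bar>x\<bar> > R \<longrightarrow> \<phi> x = 0" by auto
    then show "\<exists>K. compact K \<and> (\<forall>x. x \<notin> K \<longrightarrow> \<phi> x = 0)"
      by (intro exI[of _ "{-R..R}"]) auto
  qed
  then show ?thesis
    unfolding test_function_def times_differentiable_iff by blast
qed

lemma test_function_support:
  "test_function \<phi> \<Longrightarrow> \<exists>R>0. \<forall>x. \<bar>x\<bar> > R \<longrightarrow> \<phi> x = 0"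
  unfolding test_function_iff by blast

lemma test_function_DERIV:
  "test_function \<phi> \<Longrightarrow> (\<phi> has_real_derivative deriv \<phi> x) (at x)"
  unfolding test_function_def by (metis funpow_0 field_differentiable_derivI)

lemma test_function_isCont: "test_function \<phi> \<Longrightarrow> isCont \<phi> x"
  using test_function_DERIV DERIV_isCont by blast

lemma continuous_on_test_function:
  "test_function \<phi> \<Longrightarrow> continuous_on A f \<Longrightarrow> continuous_on A (\<lambda>x. \<phi> (f x))"
  by (rule continuous_on_compose2[of UNIV \<phi>])
     (auto intro: continuous_at_imp_continuous_on test_function_isCont)

lemma deriv_outside_support:
  assumes "\<And>x. \<bar>x\<bar> > R \<Longrightarrow> \<phi> x = 0" "\<bar>x\<bar> > (R::real)"
  shows "deriv \<phi> x = (0::real)"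
proof -
  have "open {x::real. \<bar>x\<bar> > R}"
    by (intro open_Collect_less continuous_intros)
  then have "eventually (\<lambda>y. y \<in> {x. \<bar>x\<bar> > R}) (nhds x)"
    using assms(2) by (intro eventually_nhds_in_open) auto
  then have "eventually (\<lambda>y. \<phi> y = 0) (nhds x)"
    by eventually_elim (use assms(1) in auto)
  then have "deriv \<phi> x = deriv (\<lambda>_. 0) x"
    by (intro deriv_cong_ev) auto
  then show ?thesis by simp
qed

lemma test_function_deriv [intro]:
  assumes "test_function \<phi>"
  shows "test_function (deriv \<phi>)"
proof -
  have "times_differentiable n (deriv \<phi>)" for n
    using assms[unfolded test_function_iff] times_differentiable.simps(2) by blast
  moreover from test_function_support[OF assms]
  obtain R where "R > 0" "\<And>x. \<bar>x\<bar> > R \<Longrightarrow> \<phi> x = 0"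
    by blast
  then have "\<exists>R>0. \<forall>x. \<bar>x\<bar> > R \<longrightarrow> deriv \<phi> x = 0"
    using deriv_outside_support[of R \<phi>] by auto
  ultimately show ?thesis
    unfolding test_function_iff by blast
qed

lemma test_function_iterated_deriv [intro]:
  "test_function \<phi> \<Longrightarrow> test_function ((deriv ^^ n) \<phi>)"
  by (induction n) auto

lemma deriv_lincomb:
  assumes "test_function \<phi>" "test_function \<psi>"
  shows "deriv (\<lambda>x. a * \<phi> x + b * \<psi> x) = (\<lambda>x. a * deriv \<phi> x + b * deriv \<psi> x)"
  using assms by (intro deriv_ext) (auto intro!: derivative_eq_intros test_function_DERIV)

lemma iterated_deriv_lincomb:
  assumes "test_function \<phi>" "test_function \<psi>"
  shows "(deriv ^^ n) (\<lambda>x. a * \<phi> x + b * \<psi> x) =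
    (\<lambda>x. a * (deriv ^^ n) \<phi> x + b * (deriv ^^ n) \<psi> x)"
  by (induction n) (simp_all add: deriv_lincomb test_function_iterated_deriv assms)

lemma test_function_lincomb:
  assumes "test_function \<phi>" "test_function \<psi>"
  shows "test_function (\<lambda>x. a * \<phi> x + b * \<psi> x)"
proof -
  have "(\<lambda>x. a * (deriv ^^ n) \<phi> x + b * (deriv ^^ n) \<psi> x) field_differentiable at x" for n x
    using assms by (auto intro!: derivative_intros simp: test_function_def)
  moreover obtain R R' where "R > 0" "\<forall>x. \<bar>x\<bar> > R \<longrightarrow> \<phi> x = 0" "\<forall>x. \<bar>x\<bar> > R' \<longrightarrow> \<psi> x = 0"
    using assms[THEN test_function_support] by blast
  then have "max R R' > 0" "\<forall>x. \<bar>x\<bar> > max R R' \<longrightarrow> a * \<phi> x + b * \<psi> x = 0"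
    by auto
  ultimately show ?thesis
    unfolding test_function_iff times_differentiable_iff iterated_deriv_lincomb[OF assms]
    by blast
qed

section \<open>Bump functions\<close>

text \<open>The derivatives of \<open>exp (-1/x)\<close> have the form \<open>p (1/x) * exp (-1/x)\<close> with a polynomial
  \<open>p\<close>; this class of functions is closed under differentiation, and exponential decay beats
  the polynomial at the origin.\<close>

definition exp_inverse :: "real poly \<Rightarrow> real \<Rightarrow> real" where
  "exp_inverse p x = (if x > 0 then poly p (1/x) * exp (- (1/x)) else 0)"

lemma exp_inverse_tendsto_0: "(exp_inverse p \<longlongrightarrow> 0) (at_right 0)"
proof -
  \<comment> \<open>Substitute \<open>y = 1/x\<close>.\<close>
  have "((\<lambda>y. poly p y / exp y) \<longlongrightarrow> 0) at_top"
  proof (induction p)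
    case (pCons a p)
    have "((\<lambda>y::real. 1 / exp y) \<longlongrightarrow> 0) at_top"
      using tendsto_power_div_exp_0[of 0] by simp
    then have 1: "((\<lambda>y. a * (1 / exp y)) \<longlongrightarrow> 0) at_top"
      using tendsto_mult_right_zero by blast
    have "((\<lambda>y. \<Sum>i\<le>degree p. coeff p i * (y ^ Suc i / exp y)) \<longlongrightarrow> 0) at_top"
      by (rule tendsto_null_sum) (intro tendsto_mult_right_zero tendsto_power_div_exp_0)
    also have "(\<lambda>y. \<Sum>i\<le>degree p. coeff p i * (y ^ Suc i / exp y)) = (\<lambda>y. y * poly p y / exp y)"
      by (simp add: poly_altdef sum_distrib_left sum_divide_distrib mult_ac)
    finally show ?case
      using tendsto_add[OF 1] by (auto simp: add_divide_distrib)
  qed auto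
  then have "((\<lambda>x. poly p (inverse x) / exp (inverse x)) \<longlongrightarrow> 0) (at_right 0)"
    by (rule filterlim_compose[OF _ filterlim_inverse_at_top_right])
  moreover have "eventually (\<lambda>x. poly p (inverse x) / exp (inverse x) = exp_inverse p x) (at_right 0)"
    using eventually_at_right_less[of 0]
    by eventually_elim (simp add: exp_inverse_def exp_minus inverse_eq_divide)
  ultimately show ?thesis
    by (rule Lim_transform_eventually)
qed

lemma exp_inverse_DERIV:
  "(exp_inverse p has_real_derivative exp_inverse ([:0, 0, 1:] * (p - pderiv p)) x) (at x)"
proof (cases "x = 0")
  case True
  have "((\<lambda>y. (exp_inverse p y - exp_inverse p 0) / (y - 0)) \<longlongrightarrow> 0) (at_left 0)"
    by (rule tendsto_eventually)
       (auto simp: eventually_at_filter exp_inverse_def)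
  moreover have "((\<lambda>y. (exp_inverse p y - exp_inverse p 0) / (y - 0)) \<longlongrightarrow> 0) (at_right 0)"
  proof (rule Lim_transform_eventually[OF exp_inverse_tendsto_0])
    show "eventually (\<lambda>y. exp_inverse ([:0, 1:] * p) y =
        (exp_inverse p y - exp_inverse p 0) / (y - 0)) (at_right 0)"
      by (auto simp: eventually_at_filter exp_inverse_def)
  qed
  ultimately show ?thesis
    using True by (simp add: has_field_derivative_iff filterlim_split_at exp_inverse_def)
next
  case False
  show ?thesis
  proof (cases "x > 0")
    case True
    have "((\<lambda>x. poly p (1/x) * exp (- (1/x))) has_real_derivative
        exp_inverse ([:0, 0, 1:] * (p - pderiv p)) x) (at x)"
      using True
      by (auto intro!: derivative_eq_intros DERIV_chain'[where g = "poly p"] poly_DERIV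
          simp: exp_inverse_def field_simps power2_eq_square)
    moreover have "eventually (\<lambda>y. y \<in> {0<..}) (nhds x)"
      using True by (intro eventually_nhds_in_open) auto
    then have "eventually (\<lambda>y. poly p (1/y) * exp (- (1/y)) = exp_inverse p y) (nhds x)"
      by eventually_elim (simp add: exp_inverse_def)
    ultimately show ?thesis
      using DERIV_cong_ev[of x x "\<lambda>x. poly p (1/x) * exp (- (1/x))" "exp_inverse p"] by blast
  next
    case False
    with \<open>x \<noteq> 0\<close> have "eventually (\<lambda>y. y \<in> {..<0}) (nhds x)"
      by (intro eventually_nhds_in_open) auto
    then have "eventually (\<lambda>y. exp_inverse p y = 0) (nhds x)"
      by eventually_elim (simp add: exp_inverse_def)
    with False show ?thesis
      using DERIV_cong_ev[of x x "exp_inverse p" "\<lambda>_. 0" 0 0] by (simp add: exp_inverse_def)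
  qed
qed

lemma times_differentiable_exp_inverse: "times_differentiable n (exp_inverse p)"
  by (induction n arbitrary: p)
     (simp, metis times_differentiable_SucI exp_inverse_DERIV)

text \<open>Dilating the exponents by \<open>Suc n\<close> makes the bumps increase to the indicator of the interval
  while they stay bounded by \<open>1\<close>, which makes dominated convergence applicable.\<close>

definition bump :: "real \<Rightarrow> real \<Rightarrow> nat \<Rightarrow> real \<Rightarrow> real" where
  "bump a b n x = exp_inverse 1 (real (Suc n) * (x - a)) * exp_inverse 1 (real (Suc n) * (b - x))"

lemma bump_outside: "\<not> (a < x \<and> x < b) \<Longrightarrow> bump a b n x = 0"
  by (auto simp: bump_def exp_inverse_def zero_less_mult_iff)

lemma test_function_bump: "test_function (bump a b n)"
  unfolding test_function_iff
proof (intro conjI allI exI[of _ "max 1 (max \<bar>a\<bar> \<bar>b\<bar>)"] impI)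
  fix k
  have "times_differentiable k (\<lambda>x. exp_inverse 1 (r * x + s) * exp_inverse 1 (r' * x + s'))" for r s r' s'
    by (intro times_differentiable_mult times_differentiable_affine[where f = "exp_inverse 1"]
        times_differentiable_exp_inverse)
  from this[of "real (Suc n)" "- real (Suc n) * a" "- real (Suc n)" "real (Suc n) * b"]
  show "times_differentiable k (bump a b n)"
    unfolding bump_def[abs_def] by (simp add: right_diff_distrib algebra_simps)
qed (auto intro: bump_outside)

lemma bump_bounds: "0 \<le> bump a b n x" "bump a b n x \<le> 1"
proof -
  have "0 \<le> exp_inverse 1 y" "exp_inverse 1 y \<le> 1" for y by (auto simp: exp_inverse_def)
  then show "0 \<le> bump a b n x" "bump a b n x \<le> 1"
    by (auto simp: bump_def intro: mult_le_one)
qed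

lemma bump_tendsto_indicator: "(\<lambda>n. bump a b n x) \<longlonglongrightarrow> indicator {a<..<b} x"
proof (cases "a < x \<and> x < b")
  case True
  have lim: "(\<lambda>n. exp (- (1 / (real (Suc n) * y)))) \<longlonglongrightarrow> 1" if "y > 0" for y :: real
    using that by real_asymp
  have "bump a b n x = exp (- (1 / (real (Suc n) * (x - a)))) * exp (- (1 / (real (Suc n) * (b - x))))" for n
    using True by (simp add: bump_def exp_inverse_def zero_less_mult_iff)
  then show ?thesis
    using True tendsto_mult[OF lim lim, of "x - a" "b - x"] by simp
next
  case False
  then have "indicator {a<..<b} x = (0::real)" by (simp add: indicator_def)
  with bump_outside[OF False] show ?thesis by simp
qed

section \<open>Pairings and square-integrable functions\<close>

abbreviation pairing :: "(real \<Rightarrow> real) \<Rightarrow> (real \<Rightarrow> real) \<Rightarrow> real" where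
  "pairing f \<phi> \<equiv> LINT x|lebesgue. f x * \<phi> x"

lemma borel_measurable_lebesgue_continuous:
  "continuous_on UNIV (g :: real \<Rightarrow> real) \<Longrightarrow> g \<in> borel_measurable lebesgue"
  using borel_measurable_continuous_onI measurable_completion measurable_lborel2 by blast

lemma integrable_lebesgue_bounded_support:
  fixes g :: "real \<Rightarrow> real"
  assumes "continuous_on UNIV g" "\<And>x. \<bar>x\<bar> > R \<Longrightarrow> g x = 0"
  shows "integrable lebesgue g" "(LINT x|lebesgue. g x) = integral {-R..R} g"
proof -
  have g: "set_integrable lebesgue {-R..R} g"
    using assms(1) continuous_on_subset by (intro absolutely_integrable_continuous_real) blast
  have eq: "(\<lambda>x. indicator {-R..R} x *\<^sub>R g x) = g"
    using assms(2) by (force simp: indicator_def fun_eq_iff)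
  show "integrable lebesgue g"
    using g unfolding set_integrable_def eq .
  show "(LINT x|lebesgue. g x) = integral {-R..R} g"
    using set_lebesgue_integral_eq_integral(2)[OF g] unfolding set_lebesgue_integral_def eq .
qed

lemma integrable_pairing:
  assumes f: "locally_integrable f" and \<phi>: "continuous_on UNIV \<phi>" "\<And>x. \<bar>x\<bar> > R \<Longrightarrow> \<phi> x = 0"
  shows "integrable lebesgue (\<lambda>x. f x * \<phi> x)"
proof -
  have "bounded (\<phi> ` {-R..R})"
    using \<phi>(1) by (intro compact_imp_bounded compact_continuous_image continuous_on_subset[OF \<phi>(1)]) auto
  then obtain B where B: "\<And>x. x \<in> {-R..R} \<Longrightarrow> \<bar>\<phi> x\<bar> \<le> B"
    unfolding bounded_iff by (metis imageI real_norm_def)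
  have i: "integrable lebesgue (\<lambda>x. indicator {-R..R} x *\<^sub>R f x)"
    using f unfolding locally_integrable_def set_integrable_def by auto
  have [measurable]: "\<phi> \<in> borel_measurable lebesgue"
    using \<phi>(1) by (rule borel_measurable_lebesgue_continuous)
  have "integrable lebesgue (\<lambda>x. (indicator {-R..R} x *\<^sub>R f x) * \<phi> x)"
  proof (rule Bochner_Integration.integrable_bound)
    show "integrable lebesgue (\<lambda>x. B * (indicator {-R..R} x *\<^sub>R f x))"
      using i by (rule integrable_mult_right)
    show "AE x in lebesgue. norm ((indicator {-R..R} x *\<^sub>R f x) * \<phi> x)
        \<le> norm (B * (indicator {-R..R} x *\<^sub>R f x))"
    proof (rule AE_I2)
      fix x
      show "norm ((indicator {-R..R} x *\<^sub>R f x) * \<phi> x) \<le> norm (B * (indicator {-R..R} x *\<^sub>R f x))"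
        using B[of x] by (auto simp: indicator_def abs_mult mult.commute intro!: mult_right_mono)
    qed
    have "(\<lambda>x. indicator {-R..R} x *\<^sub>R f x) \<in> borel_measurable lebesgue"
      using i by simp
    then show "(\<lambda>x. (indicator {-R..R} x *\<^sub>R f x) * \<phi> x) \<in> borel_measurable lebesgue"
      by (rule borel_measurable_times) simp
  qed
  moreover have "(\<lambda>x. (indicator {-R..R} x *\<^sub>R f x) * \<phi> x) = (\<lambda>x. f x * \<phi> x)"
    using \<phi>(2) by (force simp: indicator_def fun_eq_iff)
  ultimately show ?thesis by simp
qed

lemma continuous_test_function: "test_function \<phi> \<Longrightarrow> continuous_on UNIV \<phi>"
  using test_function_isCont continuous_at_imp_continuous_on by blast

lemma integrable_pairing_test_function:
  assumes "locally_integrable f" "test_function \<phi>"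
  shows "integrable lebesgue (\<lambda>x. f x * \<phi> x)"
  using integrable_pairing assms continuous_test_function test_function_support by metis

lemma pairing_lincomb:
  assumes "locally_integrable f" "test_function \<phi>" "test_function \<psi>"
  shows "pairing f (\<lambda>x. a * \<phi> x + b * \<psi> x) = a * pairing f \<phi> + b * pairing f \<psi>"
proof -
  have "(\<lambda>x. f x * (a * \<phi> x + b * \<psi> x)) = (\<lambda>x. a * (f x * \<phi> x) + b * (f x * \<psi> x))"
    by (auto simp: algebra_simps)
  then show ?thesis
    using assms by (simp add: integrable_pairing_test_function)
qed

lemma locally_integrable_measurable:
  assumes "locally_integrable f"
  shows "f \<in> borel_measurable lebesgue"
proof (rule borel_measurable_LIMSEQ_real)
  show "(\<lambda>n. indicator {-real n..real n} x *\<^sub>R f x) \<longlonglongrightarrow> f x" for x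
  proof (rule tendsto_eventually)
    obtain N where "\<bar>x\<bar> \<le> real N" using real_arch_simple by blast
    then show "\<forall>\<^sub>F n in sequentially. indicator {-real n..real n} x *\<^sub>R f x = f x"
      by (intro eventually_sequentiallyI[of N]) (auto simp: indicator_def)
  qed
  fix n
  have "set_integrable lebesgue {-real n..real n} f"
    using assms unfolding locally_integrable_def by auto
  then show "(\<lambda>x. indicator {-real n..real n} x *\<^sub>R f x) \<in> borel_measurable lebesgue"
    unfolding set_integrable_def by auto
qed

lemma in_L2_locally_integrable:
  assumes "in_L2 f"
  shows "locally_integrable f"
  unfolding locally_integrable_def set_integrable_def
proof (intro allI impI)
  fix K :: "real set" assume K: "compact K"
  have m: "f \<in> borel_measurable lebesgue" and i: "integrable lebesgue (\<lambda>x. (f x)\<^sup>2)"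
    using assms by (auto simp: in_L2_def)
  have [measurable]: "K \<in> sets lebesgue" using K by (simp add: lmeasurable_compact fmeasurableD)
  have "integrable lebesgue (\<lambda>x. indicator K x + (f x)\<^sup>2)"
    using i fmeasurableD2[OF lmeasurable_compact[OF K]]
    by (intro Bochner_Integration.integrable_add integrable_real_indicator) (auto simp: less_top)
  then show "integrable lebesgue (\<lambda>x. indicat_real K x *\<^sub>R f x)"
  proof (rule Bochner_Integration.integrable_bound)
    show "(\<lambda>x. indicat_real K x *\<^sub>R f x) \<in> borel_measurable lebesgue"
      using m by measurable
    have "\<bar>y\<bar> \<le> 1 + y\<^sup>2" for y :: real
      using sum_squares_bound[of "\<bar>y\<bar>" 1] by (simp add: power2_eq_square)
    then show "AE x in lebesgue. norm (indicat_real K x *\<^sub>R f x) \<le> norm (indicat_real K x + (f x)\<^sup>2)"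
      by (intro AE_I2) (auto simp: indicator_def)
  qed
qed

lemma integrable_mult_L2:
  assumes "in_L2 f" "in_L2 g"
  shows "integrable lebesgue (\<lambda>x. f x * g x)"
proof (rule Bochner_Integration.integrable_bound)
  show "integrable lebesgue (\<lambda>x. (f x)\<^sup>2 + (g x)\<^sup>2)"
    using assms by (auto simp: in_L2_def)
  show "(\<lambda>x. f x * g x) \<in> borel_measurable lebesgue"
    using assms by (auto simp: in_L2_def)
  have "\<bar>a * b\<bar> \<le> a\<^sup>2 + b\<^sup>2" for a b :: real
    using sum_squares_bound[of "\<bar>a\<bar>" "\<bar>b\<bar>"] mult_nonneg_nonneg[of "\<bar>a\<bar>" "\<bar>b\<bar>"]
    unfolding abs_mult power2_abs by linarith
  then show "AE x in lebesgue. norm (f x * g x) \<le> norm ((f x)\<^sup>2 + (g x)\<^sup>2)"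
    by auto
qed

lemma in_L2_lincomb:
  assumes "in_L2 f" "in_L2 g"
  shows "in_L2 (\<lambda>x. a * f x + b * g x)"
    "(LINT x|lebesgue. (a * f x + b * g x)\<^sup>2) = a\<^sup>2 * (LINT x|lebesgue. (f x)\<^sup>2)
       + 2 * a * b * pairing f g + b\<^sup>2 * (LINT x|lebesgue. (g x)\<^sup>2)"
proof -
  have eq: "(\<lambda>x. (a * f x + b * g x)\<^sup>2) =
      (\<lambda>x. a\<^sup>2 * (f x)\<^sup>2 + 2 * a * b * (f x * g x) + b\<^sup>2 * (g x)\<^sup>2)"
    by (auto simp: power2_eq_square algebra_simps)
  have "integrable lebesgue (\<lambda>x. (f x)\<^sup>2)" "integrable lebesgue (\<lambda>x. (g x)\<^sup>2)"
    "integrable lebesgue (\<lambda>x. f x * g x)"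
    using assms integrable_mult_L2 by (auto simp: in_L2_def)
  then show "in_L2 (\<lambda>x. a * f x + b * g x)"
    "(LINT x|lebesgue. (a * f x + b * g x)\<^sup>2) = a\<^sup>2 * (LINT x|lebesgue. (f x)\<^sup>2)
       + 2 * a * b * pairing f g + b\<^sup>2 * (LINT x|lebesgue. (g x)\<^sup>2)"
    using assms unfolding in_L2_def eq by auto
qed

lemma L2_norm_real: "L2_norm (f :: real \<Rightarrow> real) = sqrt (LINT x|lebesgue. (f x)\<^sup>2)"
  by (simp add: L2_norm_def)

lemma L2_norm_nonneg: "0 \<le> L2_norm f"
  by (simp add: L2_norm_def)

lemma L2_norm_power2: "(L2_norm (f :: real \<Rightarrow> real))\<^sup>2 = (LINT x|lebesgue. (f x)\<^sup>2)"
  by (simp add: L2_norm_real)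

lemma L2_Cauchy_Schwarz:
  assumes "in_L2 f" "in_L2 g"
  shows "\<bar>pairing f g\<bar> \<le> L2_norm f * L2_norm g"
proof -
  define A B P where "A = (LINT x|lebesgue. (f x)\<^sup>2)" "B = (LINT x|lebesgue. (g x)\<^sup>2)" "P = pairing f g"
  have AB: "A \<ge> 0" "B \<ge> 0" by (auto simp: A_B_P_def)
  \<comment> \<open>A quadratic polynomial in \<open>r\<close> without sign changes has a discriminant \<open>\<le> 0\<close>.\<close>
  have q: "0 \<le> A + 2 * r * P + r\<^sup>2 * B" for r
  proof -
    have "0 \<le> (LINT x|lebesgue. (1 * f x + r * g x)\<^sup>2)" by simp
    also have "\<dots> = A + 2 * r * P + r\<^sup>2 * B"
      unfolding in_L2_lincomb(2)[OF assms] by (simp add: A_B_P_def)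
    finally show ?thesis .
  qed
  have "P\<^sup>2 \<le> A * B"
  proof (cases "B = 0")
    case True
    have "P = 0"
    proof (rule ccontr)
      assume "P \<noteq> 0"
      then have "2 * (- (A + 1) / P) * P = - 2 * (A + 1)" by simp
      with q[of "- (A + 1) / P"] True have "0 \<le> A + - 2 * (A + 1)" by simp
      then show False using AB by simp
    qed
    then show ?thesis using AB by simp
  next
    case False
    then have "B > 0" using AB by simp
    then show ?thesis
      using q[of "- P / B"] by (simp add: field_simps power2_eq_square)
  qed
  then have "sqrt (P\<^sup>2) \<le> sqrt (A * B)" by (rule real_sqrt_le_mono)
  then show ?thesis by (simp add: L2_norm_real real_sqrt_mult A_B_P_def)
qed

lemma in_L2_test_function:
  assumes "test_function \<phi>"
  shows "in_L2 \<phi>"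
proof -
  obtain R where "\<forall>x. \<bar>x\<bar> > R \<longrightarrow> \<phi> x = 0" using test_function_support[OF assms] by blast
  then show ?thesis
    unfolding in_L2_def using continuous_test_function[OF assms]
    by (auto intro!: borel_measurable_lebesgue_continuous integrable_lebesgue_bounded_support[of _ R]
        continuous_intros)
qed

section \<open>Uniqueness of weak derivatives\<close>

text \<open>By dominated convergence; the bumps are supported in one bounded interval, on which \<open>f\<close> is
  integrable.\<close>

lemma integral_bump_tendsto:
  assumes "locally_integrable f"
  shows "(\<lambda>n. pairing f (bump a b n)) \<longlonglongrightarrow> (LINT x:{a<..<b}|lebesgue. f x)"
  unfolding set_lebesgue_integral_def
proof (rule integral_dominated_convergence)
  show "(\<lambda>x. indicat_real {a<..<b} x *\<^sub>R f x) \<in> borel_measurable lebesgue"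
    by (intro borel_measurable_scaleR borel_measurable_indicator locally_integrable_measurable[OF assms]) simp
  show "(\<lambda>x. f x * bump a b n x) \<in> borel_measurable lebesgue" for n
    by (intro borel_measurable_times locally_integrable_measurable[OF assms]
        borel_measurable_lebesgue_continuous continuous_test_function test_function_bump)
  have "integrable lebesgue (\<lambda>x. indicat_real {a..b} x *\<^sub>R f x)"
    using assms unfolding locally_integrable_def set_integrable_def by auto
  then show "integrable lebesgue (\<lambda>x. norm (indicat_real {a..b} x *\<^sub>R f x))"
    by (rule integrable_norm)
  show "AE x in lebesgue. (\<lambda>n. f x * bump a b n x) \<longlonglongrightarrow> indicat_real {a<..<b} x *\<^sub>R f x"
  proof (rule AE_I2)
    fix x
    show "(\<lambda>n. f x * bump a b n x) \<longlonglongrightarrow> indicat_real {a<..<b} x *\<^sub>R f x"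
      using tendsto_mult_left[OF bump_tendsto_indicator, of "f x" a b x] by (simp add: mult.commute)
  qed
  show "AE x in lebesgue. norm (f x * bump a b n x) \<le> norm (indicat_real {a..b} x *\<^sub>R f x)" for n
  proof (rule AE_I2)
    fix x
    have "\<bar>f x\<bar> * \<bar>bump a b n x\<bar> \<le> \<bar>f x\<bar> * 1"
      using bump_bounds[of a b n x] by (intro mult_left_mono) auto
    then show "norm (f x * bump a b n x) \<le> norm (indicat_real {a..b} x *\<^sub>R f x)"
      using bump_outside[of a x b n] by (auto simp: indicator_def abs_mult)
  qed
qed

text \<open>Integrals over Borel sets are determined by those over open intervals, which form a
  generator that is stable under intersections.\<close>

lemma AE_zero_if_interval_integrals_zero:
  fixes h :: "real \<Rightarrow> real"
  assumes h: "integrable lborel h"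
    and zero: "\<And>a b. (LINT x:{a<..<b}|lborel. h x) = 0" "(LINT x|lborel. h x) = 0"
  shows "AE x in lborel. h x = 0"
proof (rule sigma_finite_measure.density_zero[OF sigma_finite_lborel h])
  have hA: "set_integrable lborel A h" if "A \<in> sets borel" for A
    using h that unfolding set_integrable_def by (intro integrable_mult_indicator) auto
  have borel: "sets borel = sigma_sets UNIV (range (\<lambda>(a::real, b). {a<..<b}))"
    by (simp add: borel_eq_box)
  have stable: "Int_stable (range (\<lambda>(a::real, b). {a<..<b}))"
  proof (rule Int_stableI)
    fix A B assume "A \<in> range (\<lambda>(a::real, b). {a<..<b})" "B \<in> range (\<lambda>(a::real, b). {a<..<b})"
    then obtain a b a' b' where "A = {a<..<b}" "B = {a'<..<b'}" by auto
    then have "A \<inter> B = {max a a'<..<min b b'}" by auto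
    then show "A \<inter> B \<in> range (\<lambda>(a::real, b). {a<..<b})" by auto
  qed
  fix A :: "real set" assume "A \<in> sets lborel"
  then have "A \<in> sigma_sets UNIV (range (\<lambda>(a::real, b). {a<..<b}))"
    by (simp add: borel)
  with stable have "Int_stable (range (\<lambda>(a::real, b). {a<..<b}))"
    "range (\<lambda>(a::real, b). {a<..<b}) \<subseteq> Pow UNIV"
    "A \<in> sigma_sets UNIV (range (\<lambda>(a::real, b). {a<..<b}))" by auto
  then show "set_lebesgue_integral lborel A h = 0"
  proof (induction rule: sigma_sets_induct_disjoint)
    case (basic A)
    then show ?case using zero(1) by auto
  next
    case empty
    show ?case by (simp add: set_lebesgue_integral_def)
  next
    case (compl A)
    then have A: "A \<in> sets borel" by (simp add: borel)
    have "(LINT x|lborel. h x) = set_lebesgue_integral lborel (A \<union> (UNIV - A)) h"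
      by (simp add: set_lebesgue_integral_def)
    also have "\<dots> = set_lebesgue_integral lborel A h + set_lebesgue_integral lborel (UNIV - A) h"
      using A hA by (intro set_integral_Un) auto
    finally show ?case using compl zero(2) by simp
  next
    case (union A)
    have A: "A i \<in> sets lborel" for i using union by (auto simp: borel)
    have "set_lebesgue_integral lborel (\<Union>(range A)) h = (\<Sum>i. set_lebesgue_integral lborel (A i) h)"
      using A union(1) hA
      by (intro lebesgue_integral_countable_add) (auto simp: disjoint_family_on_def)
    then show ?case using union by simp
  qed
qed

text \<open>This is the fundamental lemma of the calculus of variations.\<close>

lemma AE_zero_if_pairings_zero:
  assumes f: "locally_integrable f" and zero: "\<And>\<phi>. test_function \<phi> \<Longrightarrow> pairing f \<phi> = 0"
  shows "AE x in lebesgue. f x = 0"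
proof -
  have I: "(LINT x:{a<..<b}|lebesgue. f x) = 0" for a b
    using integral_bump_tendsto[OF f, of a b] zero[OF test_function_bump] by (simp add: LIMSEQ_const_iff)
  \<comment> \<open>Passing to a Borel representative reduces the claim to sets generated by intervals.\<close>
  obtain f' where f'[measurable]: "f' \<in> borel_measurable lborel" and ae: "AE x in lborel. f x = f' x"
    using completion_ex_borel_measurable_real[OF locally_integrable_measurable[OF f]] by auto
  have ae': "AE x in lebesgue. f x = f' x" using ae by (rule AE_completion)
  have [measurable]: "f' \<in> borel_measurable lebesgue" using f' by (rule measurable_completion)
  have [measurable]: "f \<in> borel_measurable lebesgue" using f by (rule locally_integrable_measurable)
  have [measurable]: "{a<..<b} \<in> sets lebesgue" for a b :: real by simp
  have "AE x in lborel. indicator {-real n<..<real n} x *\<^sub>R f' x = 0" for n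
  proof (rule AE_zero_if_interval_integrals_zero)
    have J: "(LINT x:{a<..<b}|lborel. f' x) = 0" for a b
    proof -
      have "(LINT x:{a<..<b}|lborel. f' x) = (LINT x:{a<..<b}|lebesgue. f' x)"
        unfolding set_lebesgue_integral_def by (intro integral_completion[symmetric]) measurable
      also have "\<dots> = (LINT x:{a<..<b}|lebesgue. f x)"
        unfolding set_lebesgue_integral_def using ae' by (intro integral_cong_AE) auto
      finally show ?thesis using I by simp
    qed
    have *: "set_integrable lebesgue {-real n<..<real n} f"
      using f[unfolded locally_integrable_def, rule_format, OF compact_Icc[of "-real n" "real n"]]
      by (rule set_integrable_subset) auto
    have "integrable lebesgue (\<lambda>x. indicator {-real n<..<real n} x *\<^sub>R f' x)"
      by (rule integrable_cong_AE_imp[OF *[unfolded set_integrable_def]]) (use ae' in auto)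
    then show "integrable lborel (\<lambda>x. indicator {-real n<..<real n} x *\<^sub>R f' x)"
      by (subst (asm) integrable_completion) auto
    show "(LINT x|lborel. indicator {-real n<..<real n} x *\<^sub>R f' x) = 0"
      using J[of "-real n" "real n"] by (simp add: set_lebesgue_integral_def)
    fix a b
    have "(\<lambda>x. indicator {a<..<b} x *\<^sub>R (indicator {-real n<..<real n} x *\<^sub>R f' x)) =
      (\<lambda>x. indicator {max a (-real n)<..<min b (real n)} x *\<^sub>R f' x)"
      by (auto simp: indicator_def fun_eq_iff)
    then show "(LINT x:{a<..<b}|lborel. indicator {-real n<..<real n} x *\<^sub>R f' x) = 0"
      using J[of "max a (-real n)" "min b (real n)"] by (simp add: set_lebesgue_integral_def)
  qed
  then have "AE x in lborel. \<forall>n. indicator {-real n<..<real n} x *\<^sub>R f' x = 0"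
    unfolding AE_all_countable by blast
  then have "AE x in lborel. f' x = 0"
  proof eventually_elim
    case (elim x)
    obtain n where "\<bar>x\<bar> < real n" using reals_Archimedean2 by blast
    then show ?case using elim[rule_format, of n] by (auto simp: indicator_def split: if_splits)
  qed
  with ae have "AE x in lborel. f x = 0" by eventually_elim simp
  then show ?thesis by (rule AE_completion)
qed

lemma locally_integrable_diff:
  "locally_integrable f \<Longrightarrow> locally_integrable g \<Longrightarrow> locally_integrable (\<lambda>x. f x - g x)"
  unfolding locally_integrable_def by auto

lemma weak_deriv_unique:
  assumes "has_weak_deriv n f g" "has_weak_deriv n f g'"
  shows "AE x in lebesgue. g x = g' x"
proof -
  have l: "locally_integrable g" "locally_integrable g'" using assms by (auto simp: has_weak_deriv_def)
  have "AE x in lebesgue. g x - g' x = 0"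
  proof (rule AE_zero_if_pairings_zero)
    fix \<phi> assume \<phi>: "test_function \<phi>"
    have "(-1) ^ n * pairing g \<phi> = (-1) ^ n * pairing g' \<phi>"
      using assms \<phi> unfolding has_weak_deriv_def by simp
    then have "pairing g \<phi> = pairing g' \<phi>" by simp
    then show "pairing (\<lambda>x. g x - g' x) \<phi> = 0"
      using l \<phi> by (simp add: left_diff_distrib integrable_pairing_test_function)
  qed (use l locally_integrable_diff in auto)
  then show ?thesis by simp
qed

text \<open>Two weak derivatives agree almost everywhere, so that square integrability and the norm carry
  over from any one of them to the selected representative.\<close>

lemma weak_deriv_in_L2:
  assumes "has_weak_deriv n f g" "in_L2 g"
  shows "deriv_in_L2 n f" "has_weak_deriv n f (weak_deriv n f)" "in_L2 (weak_deriv n f)"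
    "L2_norm (weak_deriv n f) = L2_norm g"
proof -
  show "deriv_in_L2 n f" using assms by (auto simp: deriv_in_L2_def)
  show w: "has_weak_deriv n f (weak_deriv n f)"
    unfolding weak_deriv_def using someI[of "has_weak_deriv n f", OF assms(1)] .
  have ae: "AE x in lebesgue. g x = weak_deriv n f x"
    using weak_deriv_unique[OF assms(1) w] .
  have [measurable]: "g \<in> borel_measurable lebesgue" "weak_deriv n f \<in> borel_measurable lebesgue"
    using assms(1) w by (auto simp: has_weak_deriv_def locally_integrable_measurable)
  have "integrable lebesgue (\<lambda>x. (weak_deriv n f x)\<^sup>2)"
    by (rule integrable_cong_AE_imp[where g = "\<lambda>x. (g x)\<^sup>2"]) (use ae assms(2) in \<open>auto simp: in_L2_def\<close>)
  then show "in_L2 (weak_deriv n f)" by (simp add: in_L2_def)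
  have "(LINT x|lebesgue. (weak_deriv n f x)\<^sup>2) = (LINT x|lebesgue. (g x)\<^sup>2)"
    by (rule integral_cong_AE) (use ae in auto)
  then show "L2_norm (weak_deriv n f) = L2_norm g" by (simp add: L2_norm_real)
qed

section \<open>Functionals on test functions that are bounded in \<open>L\<^sup>2\<close>\<close>

text \<open>A sequence that is Cauchy at a geometric rate converges almost everywhere, since
  \<open>\<Sum>k 2\<^sup>k d\<^sub>k\<^sup>2\<close> has a finite integral for the increments \<open>d\<^sub>k\<close>; Fatou's lemma turns the
  pointwise limit into a limit in the mean.\<close>

lemma L2_complete:
  assumes L2: "\<And>k. in_L2 (f k)"
    and cauchy: "\<And>k l. k \<le> l \<Longrightarrow> (LINT x|lebesgue. (f l x - f k x)\<^sup>2) \<le> (1/4) ^ k"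
  obtains g where "in_L2 g" "\<And>k. (LINT x|lebesgue. (g x - f k x)\<^sup>2) \<le> (1/4) ^ k"
proof -
  have [measurable]: "f k \<in> borel_measurable lebesgue" for k
    using L2 by (simp add: in_L2_def)
  have nn: "(\<integral>\<^sup>+x. ennreal ((f l x - f k x)\<^sup>2) \<partial>lebesgue) \<le> ennreal ((1/4) ^ k)" if "k \<le> l" for k l
  proof -
    have "integrable lebesgue (\<lambda>x. (f l x - f k x)\<^sup>2)"
      using in_L2_lincomb(1)[OF L2 L2, of 1 l "-1" k] by (simp add: in_L2_def)
    then show ?thesis
      using cauchy[OF that] by (subst nn_integral_eq_integral) (auto intro: ennreal_leI)
  qed
  define d where "d k x = f (Suc k) x - f k x" for k x
  have [measurable]: "d k \<in> borel_measurable lebesgue" for k unfolding d_def by measurable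
  have "(\<integral>\<^sup>+x. (\<Sum>k. ennreal (2 ^ k * (d k x)\<^sup>2)) \<partial>lebesgue) =
      (\<Sum>k. \<integral>\<^sup>+x. ennreal (2 ^ k * (d k x)\<^sup>2) \<partial>lebesgue)"
    by (rule nn_integral_suminf) measurable
  also have "\<dots> \<le> (\<Sum>k. ennreal ((1/2) ^ k))"
  proof (rule suminf_le)
    fix k
    have "(\<integral>\<^sup>+x. ennreal (2 ^ k * (d k x)\<^sup>2) \<partial>lebesgue) = ennreal (2 ^ k) * (\<integral>\<^sup>+x. ennreal ((d k x)\<^sup>2) \<partial>lebesgue)"
      by (subst nn_integral_cmult[symmetric]) (auto simp: ennreal_mult')
    also have "\<dots> \<le> ennreal (2 ^ k) * ennreal ((1/4) ^ k)"
      unfolding d_def by (intro mult_left_mono nn) auto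
    also have "\<dots> = ennreal ((1/2) ^ k)"
      by (subst ennreal_mult'[symmetric]) (auto simp flip: power_mult_distrib)
    finally show "(\<integral>\<^sup>+x. ennreal (2 ^ k * (d k x)\<^sup>2) \<partial>lebesgue) \<le> ennreal ((1/2) ^ k)" .
  qed auto
  also have "\<dots> = ennreal (\<Sum>k. (1/2) ^ k)"
    by (rule suminf_ennreal2) (auto simp: summable_geometric)
  finally have "(\<integral>\<^sup>+x. (\<Sum>k. ennreal (2 ^ k * (d k x)\<^sup>2)) \<partial>lebesgue) \<noteq> \<infinity>"
    by (auto simp: top_unique)
  then have "AE x in lebesgue. (\<Sum>k. ennreal (2 ^ k * (d k x)\<^sup>2)) \<noteq> \<infinity>"
    by (intro nn_integral_PInf_AE) measurable
  then have conv: "AE x in lebesgue. (\<lambda>k. f k x) \<longlonglongrightarrow> lim (\<lambda>k. f k x)"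
  proof eventually_elim
    case (elim x)
    then have "summable (\<lambda>k. 2 ^ k * (d k x)\<^sup>2)"
      by (intro summable_suminf_not_top) auto
    then have s: "summable (\<lambda>k. 2 ^ k * (d k x)\<^sup>2 + (1/2) ^ k)"
      by (intro summable_add summable_geometric) auto
    have "norm (d k x) \<le> 2 ^ k * (d k x)\<^sup>2 + (1/2) ^ k" for k
    proof -
      define a :: real where "a = 2 ^ k"
      have "a > 0" by (simp add: a_def)
      define e where "e = a * \<bar>d k x\<bar>"
      have "0 \<le> (e - 1)\<^sup>2" "0 \<le> e" using \<open>a > 0\<close> by (auto simp: e_def)
      then have "e \<le> e\<^sup>2 + 1" by (simp add: power2_diff)
      then have "e / a \<le> (e\<^sup>2 + 1) / a" using \<open>a > 0\<close> by (simp add: divide_right_mono)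
      then have "\<bar>d k x\<bar> \<le> a * (d k x)\<^sup>2 + 1 / a"
        using \<open>a > 0\<close> by (simp add: e_def power_mult_distrib power2_eq_square[of a] add_divide_distrib)
      then show ?thesis by (simp add: a_def power_one_over)
    qed
    then have "summable (\<lambda>k. d k x)"
      by (intro summable_comparison_test'[OF s]) auto
    then have "convergent (\<lambda>n. \<Sum>k<n. d k x)" by (simp add: summable_iff_convergent)
    then have "convergent (\<lambda>n. f n x - f 0 x)"
      unfolding d_def sum_lessThan_telescope[of "\<lambda>n. f n x"] .
    then have "convergent (\<lambda>n. (f n x - f 0 x) + f 0 x)"
      by (intro convergent_add convergent_const)
    then show ?case by (simp add: convergent_LIMSEQ_iff)
  qed
  define g where "g x = lim (\<lambda>k. f k x)" for x
  have g[measurable]: "g \<in> borel_measurable lebesgue"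
    unfolding g_def by (rule borel_measurable_lim_metric) simp
  have diff: "(\<integral>\<^sup>+x. ennreal ((g x - f k x)\<^sup>2) \<partial>lebesgue) \<le> ennreal ((1/4) ^ k)" for k
  proof -
    have "AE x in lebesgue. ennreal ((g x - f k x)\<^sup>2) = liminf (\<lambda>l. ennreal ((f l x - f k x)\<^sup>2))"
      using conv
    proof eventually_elim
      case (elim x)
      have "(\<lambda>l. ennreal ((f l x - f k x)\<^sup>2)) \<longlonglongrightarrow> ennreal ((g x - f k x)\<^sup>2)"
        unfolding g_def using elim by (intro tendsto_intros)
      then show ?case by (intro lim_imp_Liminf[symmetric]) auto
    qed
    then have "(\<integral>\<^sup>+x. ennreal ((g x - f k x)\<^sup>2) \<partial>lebesgue) =
        (\<integral>\<^sup>+x. liminf (\<lambda>l. ennreal ((f l x - f k x)\<^sup>2)) \<partial>lebesgue)"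
      by (rule nn_integral_cong_AE)
    also have "\<dots> \<le> liminf (\<lambda>l. \<integral>\<^sup>+x. ennreal ((f l x - f k x)\<^sup>2) \<partial>lebesgue)"
      by (rule nn_integral_liminf) measurable
    also have "\<dots> \<le> ennreal ((1/4) ^ k)"
      by (intro Liminf_le eventually_sequentiallyI[of k] nn) auto
    finally show ?thesis .
  qed
  have i: "integrable lebesgue (\<lambda>x. (g x - f k x)\<^sup>2)" for k
  proof (rule integrableI_nonneg)
    show "(\<integral>\<^sup>+x. ennreal ((g x - f k x)\<^sup>2) \<partial>lebesgue) < \<infinity>"
      using diff[of k] by (auto intro: le_less_trans)
  qed auto
  have "in_L2 (\<lambda>x. g x - f 0 x)"
    using i[of 0] by (simp add: in_L2_def)
  from in_L2_lincomb(1)[OF this L2[of 0], of 1 1] have "in_L2 g" by simp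
  moreover have "(LINT x|lebesgue. (g x - f k x)\<^sup>2) \<le> (1/4) ^ k" for k
    using diff[of k] by (simp add: nn_integral_eq_integral[OF i])
  ultimately show ?thesis by (rule that)
qed

text \<open>The Riesz representation theorem on the (not closed) space of test functions: minimising
  sequences of \<open>\<integral>\<phi>\<^sup>2 - 2 L \<phi>\<close> are Cauchy by the parallelogram law, and the first variation shows
  that their limit represents \<open>L\<close>.\<close>

lemma Riesz_test_functions:
  assumes M: "0 \<le> M"
    and lin: "\<And>\<phi> \<psi> a b. test_function \<phi> \<Longrightarrow> test_function \<psi> \<Longrightarrow>
      L (\<lambda>x. a * \<phi> x + b * \<psi> x) = a * L \<phi> + b * L \<psi>"
    and bound: "\<And>\<phi>. test_function \<phi> \<Longrightarrow> \<bar>L \<phi>\<bar> \<le> M * L2_norm \<phi>"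
  obtains g where "in_L2 g" "L2_norm g \<le> M" "\<And>\<phi>. test_function \<phi> \<Longrightarrow> pairing g \<phi> = L \<phi>"
proof -
  define Q where "Q \<phi> = (LINT x|lebesgue. (\<phi> x)\<^sup>2)" for \<phi> :: "real \<Rightarrow> real"
  define J where "J \<phi> = Q \<phi> - 2 * L \<phi>" for \<phi>
  have Q_lincomb: "Q (\<lambda>x. a * \<phi> x + b * \<psi> x) = a\<^sup>2 * Q \<phi> + 2 * a * b * pairing \<phi> \<psi> + b\<^sup>2 * Q \<psi>"
    if "in_L2 \<phi>" "in_L2 \<psi>" for \<phi> \<psi> a b
    unfolding Q_def using in_L2_lincomb(2)[OF that] .
  have J_lower: "J \<phi> \<ge> - M\<^sup>2" if "test_function \<phi>" for \<phi>
  proof -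
    have "L \<phi> \<le> M * L2_norm \<phi>" using bound[OF that] by simp
    moreover have "Q \<phi> = (L2_norm \<phi>)\<^sup>2" by (simp add: Q_def L2_norm_power2)
    moreover have "0 \<le> (L2_norm \<phi> - M)\<^sup>2" by simp
    ultimately show ?thesis unfolding J_def power2_diff by (simp add: mult.commute)
  qed
  define m where "m = (INF \<phi>\<in>Collect test_function. J \<phi>)"
  have bdd: "bdd_below (J ` Collect test_function)"
    using J_lower by (auto intro!: bdd_belowI[of _ "- M\<^sup>2"])
  have m_le: "m \<le> J \<phi>" if "test_function \<phi>" for \<phi>
    unfolding m_def using that bdd by (intro cINF_lower) auto
  have "\<exists>\<phi>. test_function \<phi> \<and> J \<phi> < m + (1/4) ^ Suc k" for k
  proof -
    have "Collect test_function \<noteq> {}" using test_function_bump by auto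
    then show ?thesis
      using cINF_less_iff[OF _ bdd, of "m + (1/4) ^ Suc k"] by (auto simp: m_def)
  qed
  then obtain f where f: "\<And>k. test_function (f k)" "\<And>k. J (f k) < m + (1/4) ^ Suc k"
    by metis
  have f_L2: "in_L2 (f k)" for k using f(1) in_L2_test_function by blast
  have "(LINT x|lebesgue. (f l x - f k x)\<^sup>2) \<le> (1/4) ^ k" if "k \<le> l" for k l
  proof -
    have mid: "test_function (\<lambda>x. (1/2) * f l x + (1/2) * f k x)"
      using f(1) by (intro test_function_lincomb)
    have J_mid: "J (\<lambda>x. (1/2) * f l x + (1/2) * f k x) =
        (Q (f l) + 2 * pairing (f l) (f k) + Q (f k)) / 4 - (L (f l) + L (f k))"
      unfolding J_def lin[OF f(1) f(1)] Q_lincomb[OF f_L2 f_L2] by (simp add: power2_eq_square field_simps)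
    have arith: "x - 2 * p + y \<le> 2 * e + 2 * e'"
      if "m \<le> (x + 2 * p + y) / 4 - (r + s)" "x - 2 * r < m + e" "y - 2 * s < m + e'" for x p y r s e e'
      using that by argo
    have "Q (\<lambda>x. 1 * f l x + (-1) * f k x) = Q (f l) - 2 * pairing (f l) (f k) + Q (f k)"
      unfolding Q_lincomb[OF f_L2 f_L2] by simp
    also have "\<dots> \<le> 2 * (1/4) ^ Suc l + 2 * (1/4) ^ Suc k"
      using m_le[OF mid, unfolded J_mid] f(2)[of l, unfolded J_def] f(2)[of k, unfolded J_def]
      by (rule arith)
    also have "\<dots> \<le> 2 * (1/4) ^ Suc k + 2 * (1/4) ^ Suc k"
      using that by (intro add_right_mono mult_left_mono power_decreasing) auto
    also have "\<dots> = (1/4 :: real) ^ k" by simp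
    finally show ?thesis by (simp add: Q_def)
  qed
  from L2_complete[OF f_L2 this] obtain g where g: "in_L2 g"
    "\<And>k. (LINT x|lebesgue. (g x - f k x)\<^sup>2) \<le> (1/4) ^ k" by blast
  have diff_L2: "in_L2 (\<lambda>x. g x - f k x)" for k
    using in_L2_lincomb(1)[OF g(1) f_L2, of 1 "-1" k] by simp
  have norm_0: "(\<lambda>k. L2_norm (\<lambda>x. g x - f k x)) \<longlonglongrightarrow> 0"
  proof (rule tendsto_sandwich[OF _ _ tendsto_const])
    show "((\<lambda>k. (1/2 :: real) ^ k) \<longlonglongrightarrow> 0)" by (rule LIMSEQ_power_zero) simp
    have "L2_norm (\<lambda>x. g x - f k x) \<le> sqrt ((1/4) ^ k)" for k
      using g(2)[of k] by (simp add: L2_norm_real)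
    moreover have "sqrt ((1/4) ^ k) = (1/2) ^ k" for k
      by (simp add: real_sqrt_power real_sqrt_divide)
    ultimately show "\<forall>\<^sub>F k in sequentially. L2_norm (\<lambda>x. g x - f k x) \<le> (1/2) ^ k" by simp
  qed (simp add: L2_norm_nonneg)
  have pairing_conv: "(\<lambda>k. pairing h (f k)) \<longlonglongrightarrow> pairing h g" if h: "in_L2 h" for h
  proof -
    have "(\<lambda>k. pairing h (\<lambda>x. g x - f k x)) \<longlonglongrightarrow> 0"
    proof (rule Lim_null_comparison)
      show "\<forall>\<^sub>F k in sequentially. norm (pairing h (\<lambda>x. g x - f k x)) \<le> L2_norm h * L2_norm (\<lambda>x. g x - f k x)"
        using L2_Cauchy_Schwarz[OF h diff_L2] by simp
      show "(\<lambda>k. L2_norm h * L2_norm (\<lambda>x. g x - f k x)) \<longlonglongrightarrow> 0"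
        using tendsto_mult_left[OF norm_0, of "L2_norm h"] by simp
    qed
    moreover have "pairing h (\<lambda>x. g x - f k x) = pairing h g - pairing h (f k)" for k
      using integrable_mult_L2[OF h g(1)] integrable_mult_L2[OF h f_L2] by (simp add: right_diff_distrib)
    ultimately have "(\<lambda>k. pairing h g - (pairing h g - pairing h (f k))) \<longlonglongrightarrow> pairing h g - 0"
      by (intro tendsto_diff tendsto_const) simp
    then show ?thesis by simp
  qed
  have rep: "pairing g \<omega> = L \<omega>" if \<omega>: "test_function \<omega>" for \<omega>
  proof -
    have \<omega>_L2: "in_L2 \<omega>" using \<omega> by (rule in_L2_test_function)
    have est: "\<bar>pairing (f k) \<omega> - L \<omega>\<bar> \<le> (1/2) ^ k * (1 + Q \<omega>)" for k
    proof -
      define s :: real where "s = (1/2) ^ k"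
      have s: "s > 0" "(1/4) ^ Suc k \<le> s\<^sup>2"
        by (auto simp: s_def power_mult[symmetric] power2_eq_square simp flip: power_mult_distrib)
      define D where "D = pairing (f k) \<omega> - L \<omega>"
      \<comment> \<open>The step \<open>r\<close> is balanced against the error \<open>s\<^sup>2\<close> of the minimising sequence, hence \<open>r = s\<close> or \<open>r = - s\<close>.\<close>
      have var: "- (2 * r * D) \<le> r\<^sup>2 * Q \<omega> + s\<^sup>2" for r
      proof -
        have "m \<le> J (\<lambda>x. 1 * f k x + r * \<omega> x)"
          using f(1) \<omega> by (intro m_le test_function_lincomb)
        also have "\<dots> = J (f k) + 2 * r * D + r\<^sup>2 * Q \<omega>"
          unfolding J_def lin[OF f(1) \<omega>] Q_lincomb[OF f_L2 \<omega>_L2] D_def by (simp add: algebra_simps)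
        finally show ?thesis using f(2)[of k] s(2) by simp
      qed
      have "s * (2 * \<bar>D\<bar>) \<le> s * (s * (1 + Q \<omega>))"
        using var[of s] var[of "-s"] by (simp add: power2_eq_square algebra_simps abs_if)
      then have "2 * \<bar>D\<bar> \<le> s * (1 + Q \<omega>)" using s(1) by simp
      then have "\<bar>D\<bar> \<le> s * (1 + Q \<omega>)" by linarith
      then show ?thesis by (simp add: D_def s_def)
    qed
    have "(\<lambda>k. (1/2 :: real) ^ k) \<longlonglongrightarrow> 0" by (rule LIMSEQ_power_zero) simp
    from tendsto_mult_right[OF this, of "1 + Q \<omega>"]
    have "(\<lambda>k. (1/2) ^ k * (1 + Q \<omega>)) \<longlonglongrightarrow> 0" by simp
    then have "(\<lambda>k. pairing (f k) \<omega> - L \<omega>) \<longlonglongrightarrow> 0"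
      by (rule Lim_null_comparison[rotated]) (use est in simp)
    then have "(\<lambda>k. pairing (f k) \<omega>) \<longlonglongrightarrow> L \<omega>" by (simp add: LIM_zero_iff)
    moreover have "(\<lambda>k. pairing (f k) \<omega>) \<longlonglongrightarrow> pairing g \<omega>"
      using pairing_conv[OF \<omega>_L2] by (simp add: mult.commute)
    ultimately show ?thesis using LIMSEQ_unique by blast
  qed
  have "L2_norm g \<le> M"
  proof (cases "L2_norm g = 0")
    case True
    then show ?thesis using M by simp
  next
    case False
    have gg: "pairing g g = (L2_norm g)\<^sup>2" unfolding L2_norm_power2 by (simp add: power2_eq_square)
    have nf: "(\<lambda>k. L2_norm (f k)) \<longlonglongrightarrow> L2_norm g"
    proof -
      have "Q (f k) = - Q g + 2 * pairing g (f k) + Q (\<lambda>x. g x - f k x)" for k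
        using Q_lincomb[OF g(1) f_L2, of 1 "-1" k] by simp
      moreover have "(\<lambda>k. - Q g + 2 * pairing g (f k) + Q (\<lambda>x. g x - f k x)) \<longlonglongrightarrow> - Q g + 2 * pairing g g + 0\<^sup>2"
        unfolding Q_def L2_norm_power2[symmetric]
        by (intro tendsto_intros norm_0 pairing_conv g(1))
      ultimately have "(\<lambda>k. sqrt (Q (f k))) \<longlonglongrightarrow> sqrt (Q g)"
        by (intro tendsto_real_sqrt) (simp add: Q_def power2_eq_square)
      then show ?thesis by (simp add: Q_def L2_norm_real)
    qed
    have "pairing g (f k) \<le> M * L2_norm (f k)" for k
      using rep[OF f(1)] bound[OF f(1)] by (metis abs_ge_self order_trans)
    then have "pairing g g \<le> M * L2_norm g"
      by (intro LIMSEQ_le[OF pairing_conv[OF g(1)] tendsto_mult_left[OF nf]]) auto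
    then show ?thesis
      using gg False L2_norm_nonneg[of g] by (simp add: power2_eq_square)
  qed
  with g(1) rep show ?thesis using that by blast
qed

section \<open>The Riemann function of the Klein-Gordon equation\<close>

text \<open>The propagator of \<open>\<psi>\<^sub>t\<^sub>t = c\<^sup>2 \<psi>\<^sub>x\<^sub>x - 3/4 \<psi>\<close> is convolution with a function of
  \<open>z = t\<^sup>2 - y\<^sup>2/c\<^sup>2\<close> on the light cone. For \<open>z \<ge> 0\<close> this function is \<open>J\<^sub>0 (sqrt (3 z / 4))\<close>; it is entire in
  \<open>z\<close>, and \<open>riemann j\<close> below denotes its \<open>j\<close>-th derivative.\<close>

definition riemann_coeff :: "nat \<Rightarrow> real" where
  "riemann_coeff k = (- (3/16)) ^ k / (fact k)\<^sup>2"

definition riemann :: "nat \<Rightarrow> real \<Rightarrow> real" where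
  "riemann j z = (\<Sum>k. (diffs ^^ j) riemann_coeff k * z ^ k)"

lemma riemann_coeff_Suc: "(real (Suc k))\<^sup>2 * riemann_coeff (Suc k) = - (3/16) * riemann_coeff k"
  by (simp add: riemann_coeff_def power_mult_distrib divide_simps del: of_nat_Suc)

lemma summable_riemann: "summable (\<lambda>k. (diffs ^^ j) riemann_coeff k * z ^ k)"
proof (induction j arbitrary: z)
  case 0
  have "summable (\<lambda>k. inverse (fact k) * \<bar>z\<bar> ^ k)"
    by (rule summable_exp)
  moreover have "norm (riemann_coeff k * z ^ k) \<le> inverse (fact k) * \<bar>z\<bar> ^ k" for k
  proof -
    have "(3/16 :: real) ^ k \<le> 1" by (intro power_le_one) auto
    moreover have "(fact k :: real) \<le> (fact k)\<^sup>2"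
      using fact_ge_1[of k, where 'a = real] by (simp add: power2_eq_square)
    ultimately have "(3/16) ^ k / (fact k)\<^sup>2 \<le> 1 / (fact k :: real)"
      by (intro frac_le) auto
    then have "(3/16) ^ k / (fact k)\<^sup>2 * \<bar>z\<bar> ^ k \<le> inverse (fact k) * \<bar>z\<bar> ^ k"
      by (intro mult_right_mono) (auto simp: inverse_eq_divide)
    moreover have "norm (riemann_coeff k * z ^ k) = (3/16) ^ k / (fact k)\<^sup>2 * \<bar>z\<bar> ^ k"
      by (simp add: riemann_coeff_def abs_mult power_abs)
    ultimately show ?thesis by simp
  qed
  ultimately have "summable (\<lambda>k. riemann_coeff k * z ^ k)"
    by (rule summable_comparison_test'[where N = 0])
  then show ?case by simp
next
  case (Suc j)
  show ?case
    using termdiff_converges_all[OF Suc] by simp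
qed

lemma riemann_DERIV: "(riemann j has_real_derivative riemann (Suc j) z) (at z)"
  unfolding riemann_def[abs_def]
  using termdiffs_strong_converges_everywhere[OF summable_riemann, of j z] by simp

lemma isCont_riemann: "isCont (riemann j) z"
  using riemann_DERIV DERIV_isCont by blast

lemma continuous_on_riemann [continuous_intros]:
  "continuous_on A f \<Longrightarrow> continuous_on A (\<lambda>x. riemann j (f x))"
  by (rule continuous_on_compose2[of UNIV "riemann j"])
     (auto intro: continuous_at_imp_continuous_on isCont_riemann)

lemma riemann_0: "riemann 0 0 = 1"
  using powser_zero[of riemann_coeff] by (simp add: riemann_def riemann_coeff_def)

text \<open>This is Bessel's equation in the variable \<open>z\<close>, verified coefficientwise.\<close>

lemma riemann_ode: "z * riemann 2 z + riemann 1 z + 3/16 * riemann 0 z = 0"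
proof -
  define a where "a = riemann_coeff"
  have s0: "(\<lambda>k. a k * z ^ k) sums riemann 0 z"
    using summable_riemann[of 0 z] by (simp add: riemann_def a_def summable_sums)
  have s1: "(\<lambda>k. diffs a k * z ^ k) sums riemann 1 z"
    using summable_sums[OF summable_riemann[of 1 z]] by (simp add: riemann_def a_def)
  have s2: "(\<lambda>k. diffs (diffs a) k * z ^ k) sums riemann 2 z"
    using summable_sums[OF summable_riemann[of 2 z]] by (simp add: riemann_def a_def numeral_2_eq_2)
  have "(\<lambda>k. real k * diffs a k * z ^ k) sums (z * riemann 2 z)"
  proof (subst sums_Suc_iff[where f = "\<lambda>k. real k * diffs a k * z ^ k", simplified, symmetric])
    show "(\<lambda>k. (1 + real k) * diffs a (Suc k) * (z * z ^ k)) sums (z * riemann 2 z)"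
      using sums_mult[OF s2, of z] by (simp add: diffs_def mult_ac)
  qed
  from sums_add[OF sums_add[OF this s1] sums_mult[OF s0, of "3/16"]]
  have "(\<lambda>k. real k * diffs a k * z ^ k + diffs a k * z ^ k + 3/16 * (a k * z ^ k)) sums
    (z * riemann 2 z + riemann 1 z + 3/16 * riemann 0 z)" .
  moreover have "real k * diffs a k * z ^ k + diffs a k * z ^ k + 3/16 * (a k * z ^ k) = 0" for k
  proof -
    have "real k * diffs a k * z ^ k + diffs a k * z ^ k + 3/16 * (a k * z ^ k) =
        ((real (Suc k))\<^sup>2 * a (Suc k) + 3/16 * a k) * z ^ k"
      by (simp add: diffs_def power2_eq_square algebra_simps)
    then show ?thesis unfolding a_def riemann_coeff_Suc by simp
  qed
  ultimately have "(\<lambda>k. 0) sums (z * riemann 2 z + riemann 1 z + 3/16 * riemann 0 z)" by simp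
  then show ?thesis using sums_unique2 sums_zero by blast
qed

section \<open>Averages of translates\<close>

text \<open>The substitution \<open>y = c t \<eta>\<close> maps the light cone \<open>\<bar>y\<bar> \<le> c \<bar>t\<bar>\<close> to the fixed interval \<open>[-1, 1]\<close>, so
  that differentiation in \<open>t\<close> and in \<open>x\<close> both take place under the integral sign.\<close>

definition average :: "real \<Rightarrow> (real \<Rightarrow> real \<Rightarrow> real) \<Rightarrow> (real \<Rightarrow> real) \<Rightarrow> real \<Rightarrow> real \<Rightarrow> real" where
  "average c a \<phi> t x = integral {-1..1} (\<lambda>\<eta>. a t \<eta> * \<phi> (x - c * t * \<eta>))"

abbreviation jointly_continuous :: "(real \<Rightarrow> real \<Rightarrow> real) \<Rightarrow> bool" where
  "jointly_continuous a \<equiv> continuous_on UNIV (\<lambda>(t, \<eta>). a t \<eta>)"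

lemma jointly_continuous_compose:
  assumes "jointly_continuous a" "continuous_on A f" "continuous_on A g"
  shows "continuous_on A (\<lambda>x. a (f x) (g x))"
  using continuous_on_compose2[OF assms(1) continuous_on_Pair[OF assms(2,3)]] by simp

lemma average_integrand_continuous:
  assumes "jointly_continuous a" "test_function \<phi>"
  shows "continuous_on A (\<lambda>\<eta>. a t \<eta> * \<phi> (x - c * t * \<eta>))"
  by (intro continuous_intros jointly_continuous_compose[OF assms(1)]
      continuous_on_test_function[OF assms(2)])

lemma average_integrable:
  assumes "jointly_continuous a" "test_function \<phi>"
  shows "(\<lambda>\<eta>. a t \<eta> * \<phi> (x - c * t * \<eta>)) integrable_on {-1..1}"
  by (intro integrable_continuous_real average_integrand_continuous assms)

lemma average_add:
  assumes "jointly_continuous a" "test_function \<phi>" "jointly_continuous b" "test_function \<psi>"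
  shows "average c a \<phi> t x + average c b \<psi> t x =
    integral {-1..1} (\<lambda>\<eta>. a t \<eta> * \<phi> (x - c * t * \<eta>) + b t \<eta> * \<psi> (x - c * t * \<eta>))"
  unfolding average_def using average_integrable assms by (simp add: integral_add)

lemma average_jointly_continuous:
  assumes "jointly_continuous a" "test_function \<phi>"
  shows "jointly_continuous (average c a \<phi>)"
proof -
  have "continuous_on UNIV (\<lambda>p. integral (cbox (-1) 1) (\<lambda>\<eta>. a (fst p) \<eta> * \<phi> (snd p - c * fst p * \<eta>)))"
    by (rule integral_continuous_on_param)
       (auto simp: case_prod_beta intro!: continuous_intros jointly_continuous_compose[OF assms(1)]
           continuous_on_test_function[OF assms(2)])
  then show ?thesis by (simp add: average_def case_prod_beta)
qed

lemma average_DERIV_x: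
  assumes "jointly_continuous a" "test_function \<phi>"
  shows "(average c a \<phi> t has_real_derivative average c a (deriv \<phi>) t x) (at x)"
proof -
  have "((\<lambda>x. integral (cbox (-1) 1) (\<lambda>\<eta>. a t \<eta> * \<phi> (x - c * t * \<eta>))) has_real_derivative
      integral (cbox (-1) 1) (\<lambda>\<eta>. a t \<eta> * deriv \<phi> (x - c * t * \<eta>))) (at x within UNIV)"
  proof (rule leibniz_rule_field_derivative)
    fix x \<eta>
    have "((\<lambda>x. \<phi> (x - c * t * \<eta>)) has_real_derivative deriv \<phi> (x - c * t * \<eta>) * 1) (at x)"
      by (rule DERIV_chain2[OF test_function_DERIV[OF assms(2)]]) (auto intro!: derivative_eq_intros)
    then show "((\<lambda>x. a t \<eta> * \<phi> (x - c * t * \<eta>)) has_real_derivative a t \<eta> * deriv \<phi> (x - c * t * \<eta>)) (at x)"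
      using DERIV_cmult by fastforce
  next
    fix x
    show "(\<lambda>\<eta>. a t \<eta> * \<phi> (x - c * t * \<eta>)) integrable_on cbox (-1) 1"
      using average_integrable[OF assms] by simp
  next
    show "continuous_on (UNIV \<times> cbox (-1) 1) (\<lambda>(x, \<eta>). a t \<eta> * deriv \<phi> (x - c * t * \<eta>))"
      unfolding case_prod_beta
      by (intro continuous_intros jointly_continuous_compose[OF assms(1)]
          continuous_on_test_function[OF test_function_deriv[OF assms(2)]])
  qed auto
  then show ?thesis by (simp add: average_def[abs_def])
qed

lemma average_DERIV_t:
  assumes "jointly_continuous a" "jointly_continuous a'" "test_function \<phi>"
    and a': "\<And>t \<eta>. ((\<lambda>t. a t \<eta>) has_real_derivative a' t \<eta>) (at t)"
  shows "((\<lambda>t. average c a \<phi> t x) has_real_derivative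
    average c a' \<phi> t x + average c (\<lambda>t \<eta>. - c * \<eta> * a t \<eta>) (deriv \<phi>) t x) (at t)"
proof -
  have b: "jointly_continuous (\<lambda>t \<eta>. - c * \<eta> * a t \<eta>)"
    unfolding case_prod_beta by (intro continuous_intros jointly_continuous_compose[OF assms(1)])
  have "((\<lambda>t. integral (cbox (-1) 1) (\<lambda>\<eta>. a t \<eta> * \<phi> (x - c * t * \<eta>))) has_real_derivative
      integral (cbox (-1) 1) (\<lambda>\<eta>. a' t \<eta> * \<phi> (x - c * t * \<eta>) + - c * \<eta> * a t \<eta> * deriv \<phi> (x - c * t * \<eta>)))
      (at t within UNIV)"
  proof (rule leibniz_rule_field_derivative)
    fix t \<eta>
    have "((\<lambda>t. x - c * t * \<eta>) has_real_derivative - c * \<eta>) (at t)"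
      by (auto intro!: derivative_eq_intros)
    then have "((\<lambda>t. \<phi> (x - c * t * \<eta>)) has_real_derivative deriv \<phi> (x - c * t * \<eta>) * (- c * \<eta>)) (at t)"
      by (rule DERIV_chain2[OF test_function_DERIV[OF assms(3)]])
    from DERIV_mult[OF a' this]
    show "((\<lambda>t. a t \<eta> * \<phi> (x - c * t * \<eta>)) has_real_derivative
        a' t \<eta> * \<phi> (x - c * t * \<eta>) + - c * \<eta> * a t \<eta> * deriv \<phi> (x - c * t * \<eta>)) (at t)"
      by (simp add: mult_ac)
  next
    fix t
    show "(\<lambda>\<eta>. a t \<eta> * \<phi> (x - c * t * \<eta>)) integrable_on cbox (-1) 1"
      using average_integrable[OF assms(1,3)] by simp
  next
    show "continuous_on (UNIV \<times> cbox (-1) 1)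
        (\<lambda>(t, \<eta>). a' t \<eta> * \<phi> (x - c * t * \<eta>) + - c * \<eta> * a t \<eta> * deriv \<phi> (x - c * t * \<eta>))"
      unfolding case_prod_beta
      by (intro continuous_intros jointly_continuous_compose[OF assms(1)]
          jointly_continuous_compose[OF assms(2)] continuous_on_test_function[OF assms(3)]
          continuous_on_test_function[OF test_function_deriv[OF assms(3)]])
  qed auto
  then show ?thesis
    using average_add[OF assms(2,3) b test_function_deriv[OF assms(3)]] by (simp add: average_def)
qed

text \<open>Finite speed of propagation.\<close>

lemma average_support:
  assumes "\<And>x. \<bar>x\<bar> > R \<Longrightarrow> \<phi> x = 0" "\<bar>x\<bar> > R + c * \<bar>t\<bar>" "c \<ge> 0"
  shows "average c a \<phi> t x = 0"
proof -
  have "\<phi> (x - c * t * \<eta>) = 0" if "\<eta> \<in> {-1..1}" for \<eta>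
  proof (rule assms(1))
    have "\<bar>c * t * \<eta>\<bar> \<le> c * \<bar>t\<bar> * 1"
      using that assms(3) unfolding abs_mult by (intro mult_mono) auto
    then show "R < \<bar>x - c * t * \<eta>\<bar>" using assms(2) by linarith
  qed
  then have "((\<lambda>\<eta>. a t \<eta> * \<phi> (x - c * t * \<eta>)) has_integral 0) {-1..1}"
    by (intro has_integral_is_0) simp
  then show ?thesis by (simp add: average_def integral_unique)
qed

lemma iterated_deriv_average:
  assumes "jointly_continuous a" "test_function \<phi>"
  shows "(deriv ^^ n) (average c a \<phi> t) = average c a ((deriv ^^ n) \<phi>) t"
proof (induction n)
  case (Suc n)
  then show ?case
    using deriv_ext[OF average_DERIV_x[OF assms(1) test_function_iterated_deriv[OF assms(2)]]] by simp
qed auto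

lemma test_function_average:
  assumes "jointly_continuous a" "test_function \<phi>" "c \<ge> 0"
  shows "test_function (average c a \<phi> t)"
  unfolding test_function_iff times_differentiable_iff
proof (intro conjI allI impI)
  show "(deriv ^^ k) (average c a \<phi> t) field_differentiable at x" for k x
    unfolding iterated_deriv_average[OF assms(1,2)] field_differentiable_def
    using average_DERIV_x[OF assms(1) test_function_iterated_deriv[OF assms(2)]] by blast
  obtain R where "R > 0" "\<forall>x. \<bar>x\<bar> > R \<longrightarrow> \<phi> x = 0"
    using test_function_support[OF assms(2)] by blast
  then show "\<exists>R>0. \<forall>x. R < \<bar>x\<bar> \<longrightarrow> average c a \<phi> t x = 0"
    using assms(3)
    by (intro exI[of _ "R + c * \<bar>t\<bar>"]) (auto intro: add_pos_nonneg average_support[of R])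
qed

section \<open>The propagators of the Klein-Gordon equation\<close>

abbreviation sine_kernel :: "real \<Rightarrow> real \<Rightarrow> real" where
  "sine_kernel t \<eta> \<equiv> t / 2 * riemann 0 (t\<^sup>2 * (1 - \<eta>\<^sup>2))"

abbreviation sine_kernel' :: "real \<Rightarrow> real \<Rightarrow> real" where
  "sine_kernel' t \<eta> \<equiv> 1 / 2 * riemann 0 (t\<^sup>2 * (1 - \<eta>\<^sup>2)) +
     t\<^sup>2 * (1 - \<eta>\<^sup>2) * riemann 1 (t\<^sup>2 * (1 - \<eta>\<^sup>2))"

text \<open>Up to the substitution \<open>y = c t \<eta>\<close>, this is
  \<open>1/(2 c) \<integral> J\<^sub>0 (sqrt (3/4 (t\<^sup>2 - y\<^sup>2/c\<^sup>2))) \<phi>(x - y) dy\<close> over \<open>\<bar>y\<bar> \<le> c t\<close> for \<open>t > 0\<close>, the solution with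
  initial value \<open>0\<close> and initial velocity \<open>\<phi>\<close>. On the Fourier side it is multiplication by
  \<open>sin (\<omega> t) / \<omega>\<close> with \<open>\<omega>\<^sup>2 = c\<^sup>2 \<xi>\<^sup>2 + 3/4\<close>, which explains the name.\<close>

definition sine_prop :: "real \<Rightarrow> (real \<Rightarrow> real) \<Rightarrow> real \<Rightarrow> real \<Rightarrow> real" where
  "sine_prop c \<phi> = average c sine_kernel \<phi>"

text \<open>The time derivative of \<open>sine_prop c \<phi>\<close>, with the initial value \<open>\<phi>\<close> and the initial velocity
  \<open>0\<close>.\<close>

definition cosine_prop :: "real \<Rightarrow> (real \<Rightarrow> real) \<Rightarrow> real \<Rightarrow> real \<Rightarrow> real" where
  "cosine_prop c \<phi> t x = average c sine_kernel' \<phi> t x +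
     average c (\<lambda>t \<eta>. - c * \<eta> * sine_kernel t \<eta>) (deriv \<phi>) t x"

lemma jointly_continuous_kernels:
  "jointly_continuous sine_kernel" "jointly_continuous sine_kernel'"
  "jointly_continuous (\<lambda>t \<eta>. - c * \<eta> * sine_kernel t \<eta>)"
  by (auto simp: case_prod_beta intro!: continuous_intros)

lemma riemann_DERIV_t:
  "((\<lambda>t. riemann j (t\<^sup>2 * (1 - \<eta>\<^sup>2))) has_real_derivative
     riemann (Suc j) (t\<^sup>2 * (1 - \<eta>\<^sup>2)) * (2 * t * (1 - \<eta>\<^sup>2))) (at t)"
  by (rule DERIV_chain2[OF riemann_DERIV]) (auto intro!: derivative_eq_intros)

lemma riemann_DERIV_eta:
  "((\<lambda>\<eta>. riemann j (t\<^sup>2 * (1 - \<eta>\<^sup>2))) has_real_derivative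
     riemann (Suc j) (t\<^sup>2 * (1 - \<eta>\<^sup>2)) * (- 2 * t\<^sup>2 * \<eta>)) (at \<eta>)"
  by (rule DERIV_chain2[OF riemann_DERIV]) (auto intro!: derivative_eq_intros)

lemma sine_kernel_DERIV:
  "((\<lambda>t. sine_kernel t \<eta>) has_real_derivative sine_kernel' t \<eta>) (at t)"
proof -
  have "((\<lambda>t. t / 2) has_real_derivative 1 / 2) (at t)"
    by (auto intro!: derivative_eq_intros)
  from DERIV_mult[OF this riemann_DERIV_t[of 0 \<eta> t]] show ?thesis
    by (rule DERIV_cong) (simp add: power2_eq_square algebra_simps)
qed

lemma sine_prop_DERIV_t:
  assumes "test_function \<phi>"
  shows "((\<lambda>t. sine_prop c \<phi> t x) has_real_derivative cosine_prop c \<phi> t x) (at t)"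
  unfolding sine_prop_def cosine_prop_def
  by (rule average_DERIV_t[OF jointly_continuous_kernels(1,2) assms sine_kernel_DERIV])

lemma sine_kernel'_DERIV:
  "((\<lambda>t. sine_kernel' t \<eta>) has_real_derivative
     3 * t * (1 - \<eta>\<^sup>2) * riemann 1 (t\<^sup>2 * (1 - \<eta>\<^sup>2)) +
     2 * t ^ 3 * (1 - \<eta>\<^sup>2)\<^sup>2 * riemann 2 (t\<^sup>2 * (1 - \<eta>\<^sup>2))) (at t)"
proof -
  have "((\<lambda>t. t\<^sup>2 * (1 - \<eta>\<^sup>2)) has_real_derivative 2 * t * (1 - \<eta>\<^sup>2)) (at t)"
    by (auto intro!: derivative_eq_intros)
  from DERIV_add[OF DERIV_cmult[OF riemann_DERIV_t[of 0 \<eta> t], of "1/2"]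
      DERIV_mult[OF this riemann_DERIV_t[of 1 \<eta> t]]]
  show ?thesis
    by (rule DERIV_cong)
       (simp add: numeral_2_eq_2[symmetric] power2_eq_square power3_eq_cube algebra_simps)
qed

text \<open>The propagators solve the Klein-Gordon equation: the difference of its two sides is the average of an
  \<open>\<eta>\<close>-derivative of a function that vanishes at \<open>\<eta> = -1\<close> and \<open>\<eta> = 1\<close>.\<close>

lemma cosine_prop_DERIV_t:
  assumes "test_function \<phi>"
  shows "((\<lambda>t. cosine_prop c \<phi> t x) has_real_derivative
    c\<^sup>2 * sine_prop c ((deriv ^^ 2) \<phi>) t x - 3/4 * sine_prop c \<phi> t x) (at t)"
proof -
  define \<phi>' \<phi>'' where "\<phi>' = deriv \<phi>" and "\<phi>'' = deriv \<phi>'"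
  have \<phi>: "test_function \<phi>" "test_function \<phi>'" "test_function \<phi>''"
    using assms by (auto simp: \<phi>'_def \<phi>''_def)
  have \<phi>2: "(deriv ^^ 2) \<phi> = \<phi>''" by (simp add: \<phi>'_def \<phi>''_def numeral_2_eq_2)
  let ?r = "\<lambda>j t \<eta>. riemann j (t\<^sup>2 * (1 - \<eta>\<^sup>2))"
  define a1 where "a1 = (\<lambda>t \<eta>. 3 * t * (1 - \<eta>\<^sup>2) * ?r 1 t \<eta> + 2 * t ^ 3 * (1 - \<eta>\<^sup>2)\<^sup>2 * ?r 2 t \<eta>)"
  define a2 where "a2 = (\<lambda>t \<eta>. - c * \<eta> * sine_kernel' t \<eta>)"
  define a3 where "a3 = (\<lambda>t \<eta>. - c * \<eta> * (- c * \<eta> * sine_kernel t \<eta>))"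
  have cont: "jointly_continuous a1" "jointly_continuous a2" "jointly_continuous a3"
    by (auto simp: a1_def a2_def a3_def case_prod_beta intro!: continuous_intros)
  have D1: "((\<lambda>t. average c sine_kernel' \<phi> t x) has_real_derivative
      average c a1 \<phi> t x + average c a2 \<phi>' t x) (at t)"
    unfolding \<phi>'_def a2_def
    by (rule average_DERIV_t[OF jointly_continuous_kernels(2) cont(1) \<phi>(1)])
       (use sine_kernel'_DERIV in \<open>simp add: a1_def\<close>)
  have D2: "((\<lambda>t. average c (\<lambda>t \<eta>. - c * \<eta> * sine_kernel t \<eta>) \<phi>' t x) has_real_derivative
      average c a2 \<phi>' t x + average c a3 \<phi>'' t x) (at t)"
    unfolding \<phi>''_def a3_def
    by (rule average_DERIV_t[OF jointly_continuous_kernels(3) cont(2) \<phi>(2)])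
       (unfold a2_def, rule DERIV_cmult[OF sine_kernel_DERIV])
  let ?y = "\<lambda>\<eta>. x - c * t * \<eta>"
  define W where "W \<eta> = (1 - \<eta>\<^sup>2) / 2 * (c * ?r 0 t \<eta> * \<phi>' (?y \<eta>) + 2 * t * \<eta> * ?r 1 t \<eta> * \<phi> (?y \<eta>))" for \<eta>
  define w where "w \<eta> = a1 t \<eta> * \<phi> (?y \<eta>) + 2 * a2 t \<eta> * \<phi>' (?y \<eta>) + a3 t \<eta> * \<phi>'' (?y \<eta>)
      - c\<^sup>2 * (sine_kernel t \<eta> * \<phi>'' (?y \<eta>)) + 3/4 * (sine_kernel t \<eta> * \<phi> (?y \<eta>))" for \<eta>
  \<comment> \<open>\<open>w\<close> collects the integrands of both sides of the equation; Bessel's equation turns it into an exact derivative.\<close>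
  have W: "(W has_real_derivative w \<eta>) (at \<eta>)" for \<eta>
  proof -
    have y: "(?y has_real_derivative - c * t) (at \<eta>)"
      by (auto intro!: derivative_eq_intros)
    have d: "((\<lambda>\<eta>. \<phi> (?y \<eta>)) has_real_derivative \<phi>' (?y \<eta>) * (- c * t)) (at \<eta>)"
      "((\<lambda>\<eta>. \<phi>' (?y \<eta>)) has_real_derivative \<phi>'' (?y \<eta>) * (- c * t)) (at \<eta>)"
      using DERIV_chain2[OF test_function_DERIV[OF \<phi>(1)] y] DERIV_chain2[OF test_function_DERIV[OF \<phi>(2)] y]
      by (simp_all add: \<phi>'_def \<phi>''_def)
    have ode: "?r 0 t \<eta> = - 16/3 * (t\<^sup>2 * (1 - \<eta>\<^sup>2) * ?r 2 t \<eta> + ?r 1 t \<eta>)"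
      using riemann_ode[of "t\<^sup>2 * (1 - \<eta>\<^sup>2)"] by argo
    have "((\<lambda>\<eta>. (1 - \<eta>\<^sup>2) / 2) has_real_derivative - \<eta>) (at \<eta>)"
      "((\<lambda>\<eta>. 2 * t * \<eta>) has_real_derivative 2 * t) (at \<eta>)"
      by (auto intro!: derivative_eq_intros)
    note D = DERIV_mult[OF this(1) DERIV_add[OF DERIV_mult[OF DERIV_cmult[OF riemann_DERIV_eta[of 0 t \<eta>], of c] d(2)]
        DERIV_mult[OF DERIV_mult[OF this(2) riemann_DERIV_eta[of 1 t \<eta>]] d(1)]]]
    have algebra: "- e * (c * R0 * p' + 2 * t * e * R1 * p) +
        (c * (R1 * (- 2 * t\<^sup>2 * e)) * p' + p'' * (- c * t) * (c * R0) +
         ((2 * t * R1 + R2 * (- 2 * t\<^sup>2 * e) * (2 * t * e)) * p + p' * (- c * t) * (2 * t * e * R1))) *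
        ((1 - e\<^sup>2) / 2) =
        (3 * t * (1 - e\<^sup>2) * R1 + 2 * t ^ 3 * (1 - e\<^sup>2)\<^sup>2 * R2) * p +
        2 * (- c * e * (1 / 2 * R0 + t\<^sup>2 * (1 - e\<^sup>2) * R1)) * p' + - c * e * (- c * e * (t / 2 * R0)) * p'' -
        c\<^sup>2 * (t / 2 * R0 * p'') + 3 / 4 * (t / 2 * R0 * p)"
      if "R0 = - 16/3 * (t\<^sup>2 * (1 - e\<^sup>2) * R2 + R1)" for R0 R1 R2 e p p' p''
      unfolding that by (simp add: field_simps) (simp add: power2_eq_square power3_eq_cube power4_eq_xxxx algebra_simps)
    show ?thesis
      unfolding W_def[abs_def]
      by (rule DERIV_cong[OF D])
         (simp only: w_def a1_def a2_def a3_def One_nat_def[symmetric] Suc_1, rule algebra[OF ode])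
  qed
  have "(w has_integral (W 1 - W (-1))) {-1..1}"
    by (rule fundamental_theorem_of_calculus)
       (auto intro: has_field_derivative_at_within W simp flip: has_real_derivative_iff_has_vector_derivative)
  then have w0: "integral {-1..1} w = 0"
    by (simp add: W_def integral_unique)
  have "average c a1 \<phi> t x + average c a2 \<phi>' t x + (average c a2 \<phi>' t x + average c a3 \<phi>'' t x)
      - (c\<^sup>2 * sine_prop c \<phi>'' t x - 3/4 * sine_prop c \<phi> t x) = integral {-1..1} w"
  proof -
    note i = average_integrable[OF cont(1) \<phi>(1), THEN integrable_integral]
      average_integrable[OF cont(2) \<phi>(2), THEN integrable_integral]
      average_integrable[OF cont(3) \<phi>(3), THEN integrable_integral]
      average_integrable[OF jointly_continuous_kernels(1) \<phi>(3), THEN integrable_integral]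
      average_integrable[OF jointly_continuous_kernels(1) \<phi>(1), THEN integrable_integral]
    have "(w has_integral average c a1 \<phi> t x + 2 * average c a2 \<phi>' t x + average c a3 \<phi>'' t x
      - c\<^sup>2 * sine_prop c \<phi>'' t x + 3/4 * sine_prop c \<phi> t x) {-1..1}"
      unfolding w_def[abs_def] average_def sine_prop_def mult.assoc[of 2]
      by (intro has_integral_add has_integral_diff has_integral_mult_right i)
    then show ?thesis by (simp add: integral_unique)
  qed
  then have "average c a1 \<phi> t x + average c a2 \<phi>' t x + (average c a2 \<phi>' t x + average c a3 \<phi>'' t x)
      = c\<^sup>2 * sine_prop c \<phi>'' t x - 3/4 * sine_prop c \<phi> t x"
    using w0 by simp
  with DERIV_add[OF D1 D2] show ?thesis
    unfolding cosine_prop_def \<phi>2 \<phi>'_def by simp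
qed

lemma sine_prop_test_function:
  "test_function \<phi> \<Longrightarrow> 0 \<le> c \<Longrightarrow> test_function (sine_prop c \<phi> t)"
  unfolding sine_prop_def by (rule test_function_average[OF jointly_continuous_kernels(1)])

lemma iterated_deriv_sine_prop:
  "test_function \<phi> \<Longrightarrow> (deriv ^^ n) (sine_prop c \<phi> t) = sine_prop c ((deriv ^^ n) \<phi>) t"
  unfolding sine_prop_def by (rule iterated_deriv_average[OF jointly_continuous_kernels(1)])

lemma sine_prop_jointly_continuous:
  "test_function \<phi> \<Longrightarrow> jointly_continuous (sine_prop c \<phi>)"
  unfolding sine_prop_def by (rule average_jointly_continuous[OF jointly_continuous_kernels(1)])

lemma sine_prop_DERIV_x:
  "test_function \<phi> \<Longrightarrow> (sine_prop c \<phi> t has_real_derivative sine_prop c (deriv \<phi>) t x) (at x)"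
  unfolding sine_prop_def by (rule average_DERIV_x[OF jointly_continuous_kernels(1)])

lemma cosine_prop_eq:
  "cosine_prop c \<phi> t = (\<lambda>x. 1 * average c sine_kernel' \<phi> t x +
     1 * average c (\<lambda>t \<eta>. - c * \<eta> * sine_kernel t \<eta>) (deriv \<phi>) t x)"
  by (simp add: cosine_prop_def fun_eq_iff)

lemma cosine_prop_test_function:
  "test_function \<phi> \<Longrightarrow> 0 \<le> c \<Longrightarrow> test_function (cosine_prop c \<phi> t)"
  unfolding cosine_prop_eq
  by (intro test_function_lincomb test_function_average jointly_continuous_kernels(2,3) test_function_deriv)

lemma iterated_deriv_cosine_prop:
  assumes "test_function \<phi>" "0 \<le> c"
  shows "(deriv ^^ n) (cosine_prop c \<phi> t) = cosine_prop c ((deriv ^^ n) \<phi>) t"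
proof -
  have "(deriv ^^ n) (deriv \<phi>) = deriv ((deriv ^^ n) \<phi>)" by (simp add: funpow_swap1)
  moreover have "test_function (average c sine_kernel' \<phi> t)"
    "test_function (average c (\<lambda>t \<eta>. - c * \<eta> * sine_kernel t \<eta>) (deriv \<phi>) t)"
    using assms by (intro test_function_average jointly_continuous_kernels(2,3) test_function_deriv; simp)+
  ultimately show ?thesis
    unfolding cosine_prop_eq
    by (subst iterated_deriv_lincomb)
       (simp_all only: iterated_deriv_average[OF jointly_continuous_kernels(2) assms(1)]
        iterated_deriv_average[OF jointly_continuous_kernels(3) test_function_deriv[OF assms(1)]])
qed

lemma cosine_prop_jointly_continuous:
  assumes "test_function \<phi>"
  shows "jointly_continuous (cosine_prop c \<phi>)"
  using continuous_on_add[OF average_jointly_continuous[OF jointly_continuous_kernels(2) assms]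
      average_jointly_continuous[OF jointly_continuous_kernels(3) test_function_deriv[OF assms]]]
  by (simp add: cosine_prop_def case_prod_beta)

lemma cosine_prop_DERIV_x:
  assumes "test_function \<phi>" "0 \<le> c"
  shows "(cosine_prop c \<phi> t has_real_derivative cosine_prop c (deriv \<phi>) t x) (at x)"
  using test_function_DERIV[OF cosine_prop_test_function[OF assms], of t x]
    iterated_deriv_cosine_prop[OF assms, of 1 t] by simp

lemma prop_support:
  assumes "\<And>x. \<bar>x\<bar> > R \<Longrightarrow> \<phi> x = 0" "\<bar>x\<bar> > R + c * \<bar>t\<bar>" "0 \<le> c"
  shows "sine_prop c \<phi> t x = 0" "cosine_prop c \<phi> t x = 0"
  unfolding sine_prop_def cosine_prop_def
  using average_support[OF assms(1) assms(2,3)]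
    average_support[OF deriv_outside_support[OF assms(1)] assms(2,3)] by auto

lemma sine_prop_0: "sine_prop c \<phi> 0 x = 0"
  by (simp add: sine_prop_def average_def)

lemma cosine_prop_0: "cosine_prop c \<phi> 0 x = \<phi> x"
  by (simp add: cosine_prop_def average_def riemann_0)

section \<open>Conservation of energy\<close>

text \<open>By the equation the time derivative of the energy density is the \<open>x\<close>-derivative of
  \<open>2 c\<^sup>2 \<psi>\<^sub>t \<psi>\<^sub>x\<close>, which vanishes outside the light cone. At time \<open>0\<close> only the initial velocity
  contributes.\<close>

lemma energy_identity:
  assumes \<phi>: "test_function \<phi>" and c: "0 \<le> c"
  shows "(L2_norm (cosine_prop c \<phi> t))\<^sup>2 + c\<^sup>2 * (L2_norm (sine_prop c (deriv \<phi>) t))\<^sup>2 +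
    3/4 * (L2_norm (sine_prop c \<phi> t))\<^sup>2 = (L2_norm \<phi>)\<^sup>2"
proof -
  define \<phi>' where "\<phi>' = deriv \<phi>"
  have \<phi>': "test_function \<phi>'" using \<phi> by (auto simp: \<phi>'_def)
  obtain R where R: "R > 0" "\<And>x. \<bar>x\<bar> > R \<Longrightarrow> \<phi> x = 0"
    using test_function_support[OF \<phi>] by blast
  have R': "\<And>x. \<bar>x\<bar> > R \<Longrightarrow> \<phi>' x = 0"
    unfolding \<phi>'_def using deriv_outside_support[of R \<phi>] R(2) by blast
  \<comment> \<open>For all times up to \<open>\<bar>t\<bar>\<close> the solution vanishes near and beyond \<open>L\<close> and \<open>- L\<close>.\<close>
  define L where "L = R + c * \<bar>t\<bar> + 1"
  have supp: "sine_prop c \<phi> s x = 0" "cosine_prop c \<phi> s x = 0" "sine_prop c \<phi>' s x = 0"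
    if "\<bar>s\<bar> \<le> \<bar>t\<bar>" "\<bar>x\<bar> \<ge> L" for s x
  proof -
    have "c * \<bar>s\<bar> \<le> c * \<bar>t\<bar>" using that c by (intro mult_left_mono)
    then have "\<bar>x\<bar> > R + c * \<bar>s\<bar>" using that unfolding L_def by linarith
    then show "sine_prop c \<phi> s x = 0" "cosine_prop c \<phi> s x = 0" "sine_prop c \<phi>' s x = 0"
      using prop_support[OF R(2)] prop_support[OF R'] c by auto
  qed
  define e where "e s x = (cosine_prop c \<phi> s x)\<^sup>2 + c\<^sup>2 * (sine_prop c \<phi>' s x)\<^sup>2 + 3/4 * (sine_prop c \<phi> s x)\<^sup>2" for s x
  define q where "q s x = 2 * c\<^sup>2 * (cosine_prop c \<phi> s x * sine_prop c ((deriv ^^ 2) \<phi>) s x +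
    cosine_prop c \<phi>' s x * sine_prop c \<phi>' s x)" for s x
  note cont = sine_prop_jointly_continuous[OF \<phi>] sine_prop_jointly_continuous[OF \<phi>']
    sine_prop_jointly_continuous[OF test_function_iterated_deriv[OF \<phi>, of 2]]
    cosine_prop_jointly_continuous[OF \<phi>] cosine_prop_jointly_continuous[OF \<phi>']
  note cont' = cont[of c, THEN jointly_continuous_compose]
  have e_q: "((\<lambda>s. e s x) has_real_derivative q s x) (at s)" for s x
    unfolding e_def q_def
    by (rule derivative_eq_intros cosine_prop_DERIV_t[OF \<phi>] sine_prop_DERIV_t[OF \<phi>] sine_prop_DERIV_t[OF \<phi>'] refl)+
       (simp add: algebra_simps)
  have d_int: "((\<lambda>s. integral (cbox (-L) L) (e s)) has_real_derivative integral (cbox (-L) L) (q s)) (at s within UNIV)" for s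
  proof (rule leibniz_rule_field_derivative)
    show "((\<lambda>s. e s x) has_real_derivative q s x) (at s)" for s x by (rule e_q)
    show "e s integrable_on cbox (- L) L" for s
      unfolding e_def by (intro integrable_continuous continuous_intros cont')
    show "continuous_on (UNIV \<times> cbox (-L) L) (\<lambda>(s, x). q s x)"
      unfolding q_def case_prod_beta by (intro continuous_intros cont')
  qed auto
  have zero: "integral {-L..L} (q s) = 0" if "\<bar>s\<bar> \<le> \<bar>t\<bar>" for s
  proof -
    have "((\<lambda>x. 2 * c\<^sup>2 * (cosine_prop c \<phi> s x * sine_prop c \<phi>' s x)) has_real_derivative q s x) (at x)" for x
    proof -
      have "deriv \<phi>' = (deriv ^^ 2) \<phi>" by (simp add: \<phi>'_def numeral_2_eq_2)
      with DERIV_cmult[OF DERIV_mult[OF cosine_prop_DERIV_x[OF \<phi> c, of s x] sine_prop_DERIV_x[OF \<phi>', of c s x]], of "2 * c\<^sup>2"]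
      show ?thesis by (simp add: q_def \<phi>'_def algebra_simps)
    qed
    then have "(q s has_integral (2 * c\<^sup>2 * (cosine_prop c \<phi> s L * sine_prop c \<phi>' s L) -
        2 * c\<^sup>2 * (cosine_prop c \<phi> s (-L) * sine_prop c \<phi>' s (-L)))) {-L..L}"
      using R(1) c by (intro fundamental_theorem_of_calculus)
        (auto simp: L_def intro: has_field_derivative_at_within simp flip: has_real_derivative_iff_has_vector_derivative)
    then show ?thesis using supp[OF that, of L] supp[OF that, of "-L"] by (simp add: integral_unique)
  qed
  have "((\<lambda>s. integral {-L..L} (e s)) has_real_derivative 0) (at s within {-\<bar>t\<bar>..\<bar>t\<bar>})"
    if "s \<in> {-\<bar>t\<bar>..\<bar>t\<bar>}" for s
    using that has_field_derivative_subset[OF d_int[of s] subset_UNIV, of "{-\<bar>t\<bar>..\<bar>t\<bar>}"]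
      zero[of s] by (simp add: abs_le_iff)
  then obtain k where k: "\<And>s. s \<in> {-\<bar>t\<bar>..\<bar>t\<bar>} \<Longrightarrow> integral {-L..L} (e s) = k"
    using has_field_derivative_zero_constant[of "{-\<bar>t\<bar>..\<bar>t\<bar>}" "\<lambda>s. integral {-L..L} (e s)"] by auto
  have E: "(L2_norm (cosine_prop c \<phi> s))\<^sup>2 + c\<^sup>2 * (L2_norm (sine_prop c \<phi>' s))\<^sup>2 +
    3/4 * (L2_norm (sine_prop c \<phi> s))\<^sup>2 = integral {-L..L} (e s)" if "\<bar>s\<bar> \<le> \<bar>t\<bar>" for s
  proof -
    have i: "integrable lebesgue (\<lambda>x. (cosine_prop c \<phi> s x)\<^sup>2)" "integrable lebesgue (\<lambda>x. (sine_prop c \<phi>' s x)\<^sup>2)"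
      "integrable lebesgue (\<lambda>x. (sine_prop c \<phi> s x)\<^sup>2)"
      using in_L2_test_function[OF cosine_prop_test_function[OF \<phi> c]]
        in_L2_test_function[OF sine_prop_test_function[OF \<phi> c]]
        in_L2_test_function[OF sine_prop_test_function[OF \<phi>' c]] by (auto simp: in_L2_def)
    have "(LINT x|lebesgue. e s x) = integral {-L..L} (e s)"
    proof (rule integrable_lebesgue_bounded_support)
      show "continuous_on UNIV (e s)"
        unfolding e_def by (intro continuous_intros cont')
      show "e s x = 0" if "\<bar>x\<bar> > L" for x
        using supp[OF \<open>\<bar>s\<bar> \<le> \<bar>t\<bar>\<close>] that by (simp add: e_def)
    qed
    then show ?thesis using i by (simp add: e_def L2_norm_power2)
  qed
  have "L2_norm (cosine_prop c \<phi> 0) = L2_norm \<phi>" "L2_norm (sine_prop c \<psi> 0) = 0" for \<psi>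
    by (simp_all add: L2_norm_real cosine_prop_0 sine_prop_0)
  moreover have "t \<in> {-\<bar>t\<bar>..\<bar>t\<bar>}" by auto
  ultimately show ?thesis
    using E[of 0] E[of t] k[of 0] k[of t] by (simp add: \<phi>'_def)
qed

text \<open>The factor \<open>2\<close> in the last bound is a convenient majorant of \<open>2 / sqrt 3\<close>.\<close>

lemma propagator_bounds:
  assumes \<phi>: "test_function \<phi>" and c: "0 < c"
  shows "L2_norm (cosine_prop c \<phi> t) \<le> L2_norm \<phi>"
    "L2_norm (sine_prop c (deriv \<phi>) t) \<le> L2_norm \<phi> / c"
    "L2_norm (sine_prop c \<phi> t) \<le> 2 * L2_norm \<phi>"
proof -
  note e = energy_identity[OF \<phi> less_imp_le[OF c], of t]
  have "0 \<le> c\<^sup>2 * (L2_norm (sine_prop c (deriv \<phi>) t))\<^sup>2" "0 \<le> (L2_norm (sine_prop c \<phi> t))\<^sup>2"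
    "0 \<le> (L2_norm (cosine_prop c \<phi> t))\<^sup>2" by auto
  with e have b: "(L2_norm (cosine_prop c \<phi> t))\<^sup>2 \<le> (L2_norm \<phi>)\<^sup>2"
    "c\<^sup>2 * (L2_norm (sine_prop c (deriv \<phi>) t))\<^sup>2 \<le> (L2_norm \<phi>)\<^sup>2"
    "(L2_norm (sine_prop c \<phi> t))\<^sup>2 \<le> 4 * (L2_norm \<phi>)\<^sup>2"
    by (argo, argo, argo)
  show "L2_norm (cosine_prop c \<phi> t) \<le> L2_norm \<phi>"
    using b(1) by (rule power2_le_imp_le) (rule L2_norm_nonneg)
  have "c * L2_norm (sine_prop c (deriv \<phi>) t) \<le> L2_norm \<phi>"
    by (rule power2_le_imp_le) (use b(2) in \<open>auto simp: power_mult_distrib L2_norm_nonneg\<close>)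
  then show "L2_norm (sine_prop c (deriv \<phi>) t) \<le> L2_norm \<phi> / c"
    using c by (simp add: field_simps)
  show "L2_norm (sine_prop c \<phi> t) \<le> 2 * L2_norm \<phi>"
    by (rule power2_le_imp_le) (use b(3) in \<open>auto simp: power_mult_distrib L2_norm_nonneg\<close>)
qed

section \<open>Pairings of time-dependent functions\<close>

text \<open>By the mean value theorem, the quotient is a value of \<open>\<psi>'\<close> at a nearby time, and \<open>\<psi>'\<close> is
  uniformly continuous on compact sets.\<close>

lemma difference_quotient_uniform:
  fixes \<psi> \<psi>' :: "real \<Rightarrow> real \<Rightarrow> real"
  assumes \<psi>: "\<And>s x. ((\<lambda>s. \<psi> s x) has_real_derivative \<psi>' s x) (at s)"
    and cont: "jointly_continuous \<psi>'" and t: "t \<in> {0..T}" and \<epsilon>: "\<epsilon> > 0"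
  shows "\<forall>\<^sub>F s in at t within {0..T}. \<forall>x\<in>{-R..R}. \<bar>(\<psi> s x - \<psi> t x) / (s - t) - \<psi>' t x\<bar> \<le> \<epsilon>"
proof -
  have "uniformly_continuous_on ({0..T} \<times> {-R..R}) (\<lambda>(s, x). \<psi>' s x)"
    using cont by (intro compact_uniformly_continuous compact_Times) (auto intro: continuous_on_subset)
  then obtain d where d: "d > 0" "\<And>p q. p \<in> {0..T} \<times> {-R..R} \<Longrightarrow> q \<in> {0..T} \<times> {-R..R} \<Longrightarrow>
      dist q p < d \<Longrightarrow> dist (case q of (s, x) \<Rightarrow> \<psi>' s x) (case p of (s, x) \<Rightarrow> \<psi>' s x) < \<epsilon>"
    unfolding uniformly_continuous_on_def using \<epsilon> by meson
  have close: "\<bar>\<psi>' r x - \<psi>' t x\<bar> < \<epsilon>" if "r \<in> {0..T}" "\<bar>r - t\<bar> < d" "x \<in> {-R..R}" for r x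
    using d(2)[of "(t, x)" "(r, x)"] that t by (simp add: dist_real_def dist_Pair_Pair)
  have "\<bar>(\<psi> s x - \<psi> t x) / (s - t) - \<psi>' t x\<bar> \<le> \<epsilon>"
    if s: "s \<in> {0..T}" "s \<noteq> t" "dist s t < d" and x: "x \<in> {-R..R}" for s x
  proof -
    have "\<exists>r. min s t \<le> r \<and> r \<le> max s t \<and> \<psi> s x - \<psi> t x = (s - t) * \<psi>' r x"
    proof (cases "s < t")
      case True
      from MVT2[OF this, of "\<lambda>s. \<psi> s x" "\<lambda>s. \<psi>' s x"] \<psi>
      obtain r where "s < r" "r < t" "\<psi> t x - \<psi> s x = (t - s) * \<psi>' r x" by blast
      then show ?thesis by (intro exI[of _ r]) (auto simp: algebra_simps)
    next
      case False
      then have "t < s" using s by auto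
      from MVT2[OF this, of "\<lambda>s. \<psi> s x" "\<lambda>s. \<psi>' s x"] \<psi>
      obtain r where "t < r" "r < s" "\<psi> s x - \<psi> t x = (s - t) * \<psi>' r x" by blast
      then show ?thesis by (intro exI[of _ r]) auto
    qed
    then obtain r where r: "min s t \<le> r" "r \<le> max s t" "\<psi> s x - \<psi> t x = (s - t) * \<psi>' r x" by blast
    have "r \<in> {0..T}" "\<bar>r - t\<bar> < d" using r(1,2) s t by (auto simp: dist_real_def)
    from close[OF this x] r(3) s(2) show ?thesis by simp
  qed
  then show ?thesis
    unfolding eventually_at using d(1) by blast
qed

text \<open>A product rule for pairings in which both factors depend on time. The solution is merely
  continuous with values in \<open>L\<^sup>1\<close> locally, and differentiable only after pairing; the second term
  is therefore obtained from the uniform convergence of the difference quotients of \<open>\<psi>\<close>.\<close>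

lemma pairing_DERIV:
  fixes f \<psi> \<psi>' :: "real \<Rightarrow> real \<Rightarrow> real"
  assumes f: "continuous_into_L1_loc f"
    and D: "((\<lambda>s. pairing (f s) (\<psi> t)) has_real_derivative D) (at t within {0..})"
    and \<psi>: "\<And>s x. ((\<lambda>s. \<psi> s x) has_real_derivative \<psi>' s x) (at s)"
    and cont: "jointly_continuous \<psi>" "jointly_continuous \<psi>'"
    and supp: "\<And>s x. s \<in> {0..T} \<Longrightarrow> \<bar>x\<bar> > R \<Longrightarrow> \<psi> s x = 0 \<and> \<psi>' s x = 0"
    and t: "t \<in> {0..T}"
  shows "((\<lambda>s. pairing (f s) (\<psi> s)) has_real_derivative D + pairing (f t) (\<psi>' t)) (at t within {0..T})"
proof -
  define q where "q s x = (\<psi> s x - \<psi> t x) / (s - t)" for s x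
  define K where "K = {-R..R}"
  have cont1: "continuous_on UNIV (\<psi> s)" "continuous_on UNIV (\<psi>' s)" for s
    using jointly_continuous_compose[OF cont(1) continuous_on_const continuous_on_id]
      jointly_continuous_compose[OF cont(2) continuous_on_const continuous_on_id] by auto
  have loc: "locally_integrable (f s)" if "s \<in> {0..T}" for s
    using f that by (auto simp: continuous_into_L1_loc_def)
  have iK: "integrable lebesgue (\<lambda>x. indicator K x * \<bar>g x\<bar>)" if "locally_integrable g" for g
  proof -
    have "integrable lebesgue (\<lambda>x. indicator K x *\<^sub>R g x)"
      using that by (auto simp: locally_integrable_def set_integrable_def K_def)
    then have "integrable lebesgue (\<lambda>x. norm (indicator K x *\<^sub>R g x))" by (rule integrable_norm)
    then show ?thesis by (simp add: abs_mult)
  qed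
  define A where "A s = (LINT x|lebesgue. indicator K x * \<bar>f s x - f t x\<bar>)" for s
  define F where "F = (LINT x|lebesgue. indicator K x * \<bar>f t x\<bar>)"
  have "F \<ge> 0" unfolding F_def by (intro integral_nonneg_AE) auto
  have A0: "(A \<longlongrightarrow> 0) (at t within {0..T})"
  proof -
    have "((\<lambda>s. LINT x:K|lebesgue. \<bar>f s x - f t x\<bar>) \<longlongrightarrow> 0) (at t within {0..})"
      using f t by (auto simp: continuous_into_L1_loc_def K_def)
    then show ?thesis
      unfolding A_def set_lebesgue_integral_def by (simp add: tendsto_within_subset)
  qed
  have "bounded (\<psi>' t ` K)"
    unfolding K_def using cont1(2)
    by (intro compact_imp_bounded compact_continuous_image) (auto intro: continuous_on_subset)
  then obtain B where B: "\<And>x. x \<in> K \<Longrightarrow> \<bar>\<psi>' t x\<bar> \<le> B"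
    unfolding bounded_iff by (metis imageI real_norm_def)
  have q: "((\<lambda>s. pairing (f s) (q s)) \<longlongrightarrow> pairing (f t) (\<psi>' t)) (at t within {0..T})"
  proof (rule tendstoI)
    fix e :: real assume e: "e > 0"
    define \<epsilon> where "\<epsilon> = min 1 (e / (2 * (F + 1)))"
    have \<epsilon>: "\<epsilon> > 0" "\<epsilon> \<le> 1" "\<epsilon> * F < e / 2"
    proof -
      show "\<epsilon> > 0" using e \<open>F \<ge> 0\<close> by (auto simp: \<epsilon>_def)
      have "\<epsilon> * F \<le> e / (2 * (F + 1)) * F" using \<open>F \<ge> 0\<close> by (intro mult_right_mono) (auto simp: \<epsilon>_def)
      also have "\<dots> < e / 2" using e \<open>F \<ge> 0\<close> by (simp add: field_simps)
      finally show "\<epsilon> * F < e / 2" .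
    qed (simp add: \<epsilon>_def)
    define \<delta> where "\<delta> = e / (2 * (\<bar>B\<bar> + 1))"
    have "\<delta> > 0" using e by (simp add: \<delta>_def)
    have "\<forall>\<^sub>F s in at t within {0..T}. dist (A s) 0 < \<delta>"
      using A0 \<open>\<delta> > 0\<close> by (rule tendstoD)
    moreover have "\<forall>\<^sub>F s in at t within {0..T}. s \<in> {0..T} \<and> s \<noteq> t"
      by (simp add: eventually_at_filter)
    moreover note difference_quotient_uniform[where R = R, OF \<psi> cont(2) t \<epsilon>(1)]
    ultimately show "\<forall>\<^sub>F s in at t within {0..T}. dist (pairing (f s) (q s)) (pairing (f t) (\<psi>' t)) < e"
    proof eventually_elim
      case (elim s)
      then have s: "s \<in> {0..T}" "s \<noteq> t" by auto
      have q_out: "q s x = 0" if "\<bar>x\<bar> > R" for x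
        using supp[OF s(1) that] supp[OF t that] by (simp add: q_def)
      have int: "integrable lebesgue (\<lambda>x. f s x * q s x)" "integrable lebesgue (\<lambda>x. f t x * \<psi>' t x)"
        using supp[OF t] s q_out cont1 unfolding q_def
        by (intro integrable_pairing[of _ _ R] loc t continuous_intros; auto)+
      have "\<bar>f s x * q s x - f t x * \<psi>' t x\<bar> \<le>
          (\<bar>B\<bar> + 1) * (indicator K x * \<bar>f s x - f t x\<bar>) + \<epsilon> * (indicator K x * \<bar>f t x\<bar>)" for x
      proof (cases "x \<in> K")
        case True
        have d: "\<bar>q s x - \<psi>' t x\<bar> \<le> \<epsilon>" using elim True by (simp add: q_def K_def)
        then have "\<bar>q s x\<bar> \<le> \<bar>B\<bar> + 1" using B[OF True] \<epsilon>(2) by linarith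
        moreover have "f s x * q s x - f t x * \<psi>' t x = q s x * (f s x - f t x) + (q s x - \<psi>' t x) * f t x"
          by (simp add: algebra_simps)
        then have "\<bar>f s x * q s x - f t x * \<psi>' t x\<bar> \<le> \<bar>q s x\<bar> * \<bar>f s x - f t x\<bar> + \<bar>q s x - \<psi>' t x\<bar> * \<bar>f t x\<bar>"
          by (simp add: abs_mult[symmetric])
        ultimately have "\<bar>f s x * q s x - f t x * \<psi>' t x\<bar> \<le> (\<bar>B\<bar> + 1) * \<bar>f s x - f t x\<bar> + \<epsilon> * \<bar>f t x\<bar>"
          using mult_right_mono[OF d, of "\<bar>f t x\<bar>"] mult_right_mono[of "\<bar>q s x\<bar>" "\<bar>B\<bar> + 1" "\<bar>f s x - f t x\<bar>"]
          by linarith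
        then show ?thesis using True by simp
      next
        case False
        then have "\<bar>x\<bar> > R" by (auto simp: K_def)
        then show ?thesis using False q_out supp[OF t] by simp
      qed
      then have "(LINT x|lebesgue. \<bar>f s x * q s x - f t x * \<psi>' t x\<bar>) \<le>
          (LINT x|lebesgue. (\<bar>B\<bar> + 1) * (indicator K x * \<bar>f s x - f t x\<bar>) + \<epsilon> * (indicator K x * \<bar>f t x\<bar>))"
        using int iK[OF loc[OF t]] iK[OF locally_integrable_diff[OF loc[OF s(1)] loc[OF t]]]
        by (intro integral_mono) auto
      also have "\<dots> = (\<bar>B\<bar> + 1) * A s + \<epsilon> * F"
        using iK[OF loc[OF t]] iK[OF locally_integrable_diff[OF loc[OF s(1)] loc[OF t]]]
        by (simp add: A_def F_def)
      also have "\<dots> < e"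
      proof -
        have "(\<bar>B\<bar> + 1) * A s \<le> (\<bar>B\<bar> + 1) * \<delta>" using elim(1) by (intro mult_left_mono) auto
        also have "\<dots> = e / 2" by (simp add: \<delta>_def field_simps)
        finally show ?thesis using \<epsilon>(3) by linarith
      qed
      finally have "(LINT x|lebesgue. \<bar>f s x * q s x - f t x * \<psi>' t x\<bar>) < e" .
      moreover have "\<bar>LINT x|lebesgue. f s x * q s x - f t x * \<psi>' t x\<bar> \<le>
          (LINT x|lebesgue. \<bar>f s x * q s x - f t x * \<psi>' t x\<bar>)" by (rule integral_abs_bound)
      ultimately show ?case using int by (simp add: dist_real_def)
    qed
  qed
  have D': "((\<lambda>s. (pairing (f s) (\<psi> t) - pairing (f t) (\<psi> t)) / (s - t)) \<longlongrightarrow> D) (at t within {0..T})"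
    using has_field_derivative_subset[OF D, of "{0..T}"] by (auto simp: has_field_derivative_iff)
  have "\<forall>\<^sub>F s in at t within {0..T}. (pairing (f s) (\<psi> t) - pairing (f t) (\<psi> t)) / (s - t) + pairing (f s) (q s) =
      (pairing (f s) (\<psi> s) - pairing (f t) (\<psi> t)) / (s - t)"
  proof -
    have "(pairing (f s) (\<psi> t) - pairing (f t) (\<psi> t)) / (s - t) + pairing (f s) (q s) =
      (pairing (f s) (\<psi> s) - pairing (f t) (\<psi> t)) / (s - t)" if s: "s \<in> {0..T}" "s \<noteq> t" for s
    proof -
      have i: "integrable lebesgue (\<lambda>x. f s x * \<psi> r x)" if "r \<in> {0..T}" for r
        using supp[OF that] by (intro integrable_pairing[of _ _ R] loc s(1) cont1) auto
      have "pairing (f s) (q s) = (LINT x|lebesgue. (f s x * \<psi> s x - f s x * \<psi> t x) / (s - t))"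
        by (simp add: q_def right_diff_distrib)
      also have "\<dots> = (pairing (f s) (\<psi> s) - pairing (f s) (\<psi> t)) / (s - t)"
        using i[OF s(1)] i[OF t] by simp
      finally show ?thesis by (simp add: add_divide_distrib[symmetric])
    qed
    then show ?thesis by (auto simp: eventually_at_filter)
  qed
  with tendsto_add[OF D' q] show ?thesis
    unfolding has_field_derivative_iff by (rule Lim_transform_eventually)
qed

section \<open>Duality\<close>

text \<open>The quantity \<open>G s\<close> pairs the solution at time \<open>s\<close> with the propagators over the remaining
  time \<open>t - s\<close>. It is constant since the propagators solve the adjoint problem; evaluating it at
  \<open>s = t\<close> and at \<open>s = 0\<close> gives the two sides.\<close>

lemma solution_at_time_by_duality:
  assumes \<gamma>: "\<gamma> > 0" and sol: "solves_cauchy \<gamma> u E u0 E0"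
    and \<phi>: "test_function \<phi>" and t: "t \<ge> 0"
  shows "exp (t / 2) * pairing (E t) \<phi> = pairing (E 0) (cosine_prop (sqrt \<gamma>) \<phi> t)
    + 1/2 * pairing (E 0) (sine_prop (sqrt \<gamma>) \<phi> t) + pairing (u 0) (sine_prop (sqrt \<gamma>) \<phi> t)"
proof -
  define c where "c = sqrt \<gamma>"
  have c: "0 \<le> c" "c\<^sup>2 = \<gamma>" using \<gamma> by (auto simp: c_def)
  define \<phi>'' where "\<phi>'' = (deriv ^^ 2) \<phi>"
  have \<phi>'': "test_function \<phi>''" using \<phi> by (auto simp: \<phi>''_def)
  have cont: "continuous_into_L1_loc u" "continuous_into_L1_loc E"
    using sol by (auto simp: solves_cauchy_def)
  have loc: "locally_integrable (E s)" "locally_integrable (u s)" if "s \<ge> 0" for s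
    using cont that by (auto simp: continuous_into_L1_loc_def)
  have du: "((\<lambda>s. pairing (u s) \<psi>) has_real_derivative
      \<gamma> * pairing (E s) ((deriv ^^ 2) \<psi>) - pairing (E s) \<psi> - pairing (u s) \<psi>) (at s within {0..})"
    and dE: "((\<lambda>s. pairing (E s) \<psi>) has_real_derivative pairing (u s) \<psi>) (at s within {0..})"
    if "test_function \<psi>" "s \<ge> 0" for \<psi> s
    using sol that by (auto simp: solves_cauchy_def)
  let ?S = "\<lambda>s. sine_prop c \<phi> (t - s)" and ?C = "\<lambda>s. cosine_prop c \<phi> (t - s)"
    and ?S'' = "\<lambda>s. sine_prop c \<phi>'' (t - s)"
  have test: "test_function (?S s)" "test_function (?C s)" "test_function (?S'' s)" for s
    using \<phi> \<phi>'' c sine_prop_test_function cosine_prop_test_function by auto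
  obtain R where R: "R > 0" "\<And>x. \<bar>x\<bar> > R \<Longrightarrow> \<phi> x = 0" "\<And>x. \<bar>x\<bar> > R \<Longrightarrow> \<phi>'' x = 0"
  proof -
    obtain R R' where "R > 0" "\<forall>x. \<bar>x\<bar> > R \<longrightarrow> \<phi> x = 0" "R' > 0" "\<forall>x. \<bar>x\<bar> > R' \<longrightarrow> \<phi>'' x = 0"
      using test_function_support[OF \<phi>] test_function_support[OF \<phi>''] by blast
    then show ?thesis by (intro that[of "max R R'"]) auto
  qed
  have supp: "?S s x = 0" "?C s x = 0" "?S'' s x = 0" if "s \<in> {0..t}" "\<bar>x\<bar> > R + c * t" for s x
  proof -
    have "c * \<bar>t - s\<bar> \<le> c * t" using that c(1) by (intro mult_left_mono) auto
    then have "\<bar>x\<bar> > R + c * \<bar>t - s\<bar>" using that by linarith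
    then show "?S s x = 0" "?C s x = 0" "?S'' s x = 0"
      using prop_support[OF R(2)] prop_support[OF R(3)] c(1) by auto
  qed
  have shift: "((\<lambda>s. h (t - s)) has_real_derivative - D) (at s)"
    if "(h has_real_derivative D) (at (t - s))" for h D s
  proof -
    have "((\<lambda>s. t - s) has_real_derivative - 1) (at s)"
      by (auto intro!: derivative_eq_intros)
    from DERIV_chain2[where f = h and g = "\<lambda>s. t - s", OF that this] show ?thesis by simp
  qed
  have dS: "((\<lambda>s. ?S s x) has_real_derivative - ?C s x) (at s)" for s x
    using shift[OF sine_prop_DERIV_t[OF \<phi>]] .
  have dC: "((\<lambda>s. ?C s x) has_real_derivative (- \<gamma>) * ?S'' s x + 3/4 * ?S s x) (at s)" for s x
    using shift[OF cosine_prop_DERIV_t[OF \<phi>, of c x "t - s"]] by (simp add: c(2) \<phi>''_def algebra_simps)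
  note jc = sine_prop_jointly_continuous[OF \<phi>, of c] cosine_prop_jointly_continuous[OF \<phi>, of c]
    sine_prop_jointly_continuous[OF \<phi>'', of c]
  have jc': "jointly_continuous ?S" "jointly_continuous ?C" "jointly_continuous (\<lambda>s x. - ?C s x)"
    "jointly_continuous (\<lambda>s x. (- \<gamma>) * ?S'' s x + 3/4 * ?S s x)"
    unfolding case_prod_beta by (intro continuous_intros jc[THEN jointly_continuous_compose])+
  define G where "G s = exp (s / 2) * (pairing (E s) (?C s) + 1/2 * pairing (E s) (?S s) + pairing (u s) (?S s))" for s
  have "(G has_real_derivative 0) (at s within {0..t})" if s: "s \<in> {0..t}" for s
  proof -
    have s0: "s \<ge> 0" using s by simp
    have neg: "pairing f (\<lambda>x. - ?C s x) = - pairing f (?C s)" for f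
      by simp
    have S2: "(deriv ^^ 2) (?S s) = ?S'' s"
      unfolding \<phi>''_def by (rule iterated_deriv_sine_prop[OF \<phi>])
    have 1: "((\<lambda>s. pairing (E s) (?C s)) has_real_derivative
        pairing (u s) (?C s) + ((- \<gamma>) * pairing (E s) (?S'' s) + 3/4 * pairing (E s) (?S s))) (at s within {0..t})"
      using pairing_DERIV[where R = "R + c * t", OF cont(2) dE[OF test(2) s0] dC jc'(2,4) _ s] supp
      by (simp only: pairing_lincomb[OF loc(1)[OF s0] test(3,1)]) simp
    have 2: "((\<lambda>s. pairing (E s) (?S s)) has_real_derivative
        pairing (u s) (?S s) + - pairing (E s) (?C s)) (at s within {0..t})"
      using pairing_DERIV[where R = "R + c * t", OF cont(2) dE[OF test(1) s0] dS jc'(1,3) _ s] supp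
      by (simp only: neg) simp
    have 3: "((\<lambda>s. pairing (u s) (?S s)) has_real_derivative
        \<gamma> * pairing (E s) (?S'' s) - pairing (E s) (?S s) - pairing (u s) (?S s) + - pairing (u s) (?C s)) (at s within {0..t})"
      using pairing_DERIV[where R = "R + c * t", OF cont(1) du[OF test(1) s0] dS jc'(1,3) _ s] supp
      by (simp only: neg S2) simp
    have 4: "((\<lambda>s. exp (s / 2)) has_real_derivative exp (s / 2) * (1 / 2)) (at s within {0..t})"
      by (auto intro!: derivative_eq_intros)
    show ?thesis
      unfolding G_def[abs_def]
      by (rule DERIV_cong[OF DERIV_mult[OF 4 DERIV_add[OF DERIV_add[OF 1 DERIV_cmult[OF 2, of "1/2"]] 3]]])
         (simp add: field_simps)
  qed
  then obtain k where "\<And>s. s \<in> {0..t} \<Longrightarrow> G s = k"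
    using has_field_derivative_zero_constant[of "{0..t}" G] by auto
  then have "G t = G 0" using t by simp
  moreover have "cosine_prop c \<phi> 0 = \<phi>" "sine_prop c \<phi> 0 = (\<lambda>x. 0)"
    by (auto simp: cosine_prop_0 sine_prop_0)
  ultimately show ?thesis by (simp add: G_def c_def)
qed

text \<open>This is the time derivative of the preceding identity, as \<open>u = E\<^sub>t\<close>.\<close>

lemma velocity_at_time_by_duality:
  assumes \<gamma>: "\<gamma> > 0" and sol: "solves_cauchy \<gamma> u E u0 E0"
    and \<phi>: "test_function \<phi>" and t: "t \<ge> 0"
  shows "exp (t / 2) * pairing (u t) \<phi> = \<gamma> * pairing (E 0) (sine_prop (sqrt \<gamma>) ((deriv ^^ 2) \<phi>) t)
    - pairing (E 0) (sine_prop (sqrt \<gamma>) \<phi> t)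
    + pairing (u 0) (cosine_prop (sqrt \<gamma>) \<phi> t) - 1/2 * pairing (u 0) (sine_prop (sqrt \<gamma>) \<phi> t)"
proof -
  define c where "c = sqrt \<gamma>"
  have c: "0 \<le> c" "c\<^sup>2 = \<gamma>" using \<gamma> by (auto simp: c_def)
  define \<phi>'' where "\<phi>'' = (deriv ^^ 2) \<phi>"
  have \<phi>'': "test_function \<phi>''" using \<phi> by (auto simp: \<phi>''_def)
  have loc: "locally_integrable (E 0)" "locally_integrable (u 0)"
    using sol by (auto simp: solves_cauchy_def continuous_into_L1_loc_def)
  let ?S = "sine_prop c \<phi>" and ?C = "cosine_prop c \<phi>" and ?S'' = "sine_prop c \<phi>''"
  have test: "test_function (?S s)" "test_function (?C s)" "test_function (?S'' s)" for s
    using \<phi> \<phi>'' c sine_prop_test_function cosine_prop_test_function by auto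
  obtain R where R: "R > 0" "\<And>x. \<bar>x\<bar> > R \<Longrightarrow> \<phi> x = 0" "\<And>x. \<bar>x\<bar> > R \<Longrightarrow> \<phi>'' x = 0"
  proof -
    obtain R R' where "R > 0" "\<forall>x. \<bar>x\<bar> > R \<longrightarrow> \<phi> x = 0" "R' > 0" "\<forall>x. \<bar>x\<bar> > R' \<longrightarrow> \<phi>'' x = 0"
      using test_function_support[OF \<phi>] test_function_support[OF \<phi>''] by blast
    then show ?thesis by (intro that[of "max R R'"]) auto
  qed
  have supp: "?S s x = 0" "?C s x = 0" "?S'' s x = 0" if "s \<in> {0..t+1}" "\<bar>x\<bar> > R + c * (t + 1)" for s x
  proof -
    have "c * \<bar>s\<bar> \<le> c * (t + 1)" using that c(1) by (intro mult_left_mono) auto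
    then have "\<bar>x\<bar> > R + c * \<bar>s\<bar>" using that by linarith
    then show "?S s x = 0" "?C s x = 0" "?S'' s x = 0"
      using prop_support[OF R(2)] prop_support[OF R(3)] c(1) by auto
  qed
  have dC: "((\<lambda>s. ?C s x) has_real_derivative \<gamma> * ?S'' s x + (- 3/4) * ?S s x) (at s)" for s x
    using cosine_prop_DERIV_t[OF \<phi>, of c x s] by (simp add: c(2) \<phi>''_def)
  note jc = sine_prop_jointly_continuous[OF \<phi>, of c] cosine_prop_jointly_continuous[OF \<phi>, of c]
    sine_prop_jointly_continuous[OF \<phi>'', of c]
  have jc': "jointly_continuous (\<lambda>s x. \<gamma> * ?S'' s x + (- 3/4) * ?S s x)"
    unfolding case_prod_beta by (intro continuous_intros jc[THEN jointly_continuous_compose])+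
  \<comment> \<open>The product rule is applied with the initial data as a factor that is constant in time.\<close>
  have const: "continuous_into_L1_loc (\<lambda>s. f)" if "locally_integrable f" for f
    using that by (simp add: continuous_into_L1_loc_def set_lebesgue_integral_def)
  have tT: "t \<in> {0..t+1}" using t by simp
  define H where "H s = pairing (E 0) (?C s) + 1/2 * pairing (E 0) (?S s) + pairing (u 0) (?S s)" for s
  define H' where "H' = (0 + (\<gamma> * pairing (E 0) (?S'' t) + (- 3/4) * pairing (E 0) (?S t)))
    + 1/2 * (0 + pairing (E 0) (?C t)) + (0 + pairing (u 0) (?C t))"
  have 1: "((\<lambda>s. pairing (E 0) (?C s)) has_real_derivative
      0 + (\<gamma> * pairing (E 0) (?S'' t) + (- 3/4) * pairing (E 0) (?S t))) (at t within {0..t+1})"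
    using pairing_DERIV[where R = "R + c * (t + 1)", OF const[OF loc(1)] DERIV_const dC jc(2) jc' _ tT] supp
    by (simp only: pairing_lincomb[OF loc(1) test(3,1)]) simp
  have 2: "((\<lambda>s. pairing f (?S s)) has_real_derivative 0 + pairing f (?C t)) (at t within {0..t+1})"
    if "locally_integrable f" for f
    using supp
    by (intro pairing_DERIV[where R = "R + c * (t + 1)", OF const[OF that] DERIV_const sine_prop_DERIV_t[OF \<phi>] jc(1,2) _ tT]) auto
  have H: "(H has_real_derivative H') (at t within {0..t+1})"
    unfolding H_def[abs_def] H'_def by (intro DERIV_add DERIV_cmult 1 2 loc)
  have "((\<lambda>s. exp (- (s / 2)) * H s) has_real_derivative
      exp (- (t / 2)) * (- 1 / 2) * H t + H' * exp (- (t / 2))) (at t within {0..t+1})"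
    by (rule DERIV_mult[OF _ H]) (auto intro!: derivative_eq_intros)
  then have dE1: "((\<lambda>s. exp (- (s / 2)) * H s) has_real_derivative
      exp (- (t / 2)) * (- 1 / 2) * H t + H' * exp (- (t / 2))) (at_right t)"
    using has_field_derivative_subset[of _ _ t "{0..t+1}" "{t..t+1}"] t
    by (simp add: at_within_Icc_at_right)
  have E_eq: "pairing (E s) \<phi> = exp (- (s / 2)) * H s" if "s \<ge> 0" for s
    using solution_at_time_by_duality[OF \<gamma> sol \<phi> that]
    by (simp add: H_def c_def exp_minus field_simps)
  have "((\<lambda>s. pairing (E s) \<phi>) has_real_derivative pairing (u t) \<phi>) (at t within {0..})"
    using sol \<phi> t by (auto simp: solves_cauchy_def)
  \<comment> \<open>Derivatives from the right are unique, also at \<open>t = 0\<close>.\<close>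
  then have "((\<lambda>s. pairing (E s) \<phi>) has_real_derivative pairing (u t) \<phi>) (at t within {t..t+1})"
    by (rule has_field_derivative_subset) (use t in auto)
  then have "((\<lambda>s. exp (- (s / 2)) * H s) has_real_derivative pairing (u t) \<phi>) (at t within {t..t+1})"
    by (rule has_field_derivative_transform_within[where d = 1]) (use t E_eq in auto)
  then have "((\<lambda>s. exp (- (s / 2)) * H s) has_real_derivative pairing (u t) \<phi>) (at_right t)"
    by (simp add: at_within_Icc_at_right)
  with dE1 have "pairing (u t) \<phi> = exp (- (t / 2)) * (- 1 / 2) * H t + H' * exp (- (t / 2))"
    unfolding has_field_derivative_iff
    by (intro tendsto_unique[OF trivial_limit_at_right_real])
  then have "exp (t / 2) * pairing (u t) \<phi> = H' - 1 / 2 * H t"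
    by (simp add: exp_minus field_simps)
  then show ?thesis
    by (simp add: H'_def H_def c_def \<phi>''_def field_simps)
qed

section \<open>Bounds on weak derivatives\<close>

text \<open>The Riesz representative of \<open>\<phi> \<mapsto> \<langle>f, \<partial>\<^sup>n \<phi>\<rangle>\<close> is the weak derivative up to the sign \<open>(-1)\<^sup>n\<close>.\<close>

lemma weak_deriv_by_duality:
  assumes f: "locally_integrable f" and M: "0 \<le> M"
    and bound: "\<And>\<phi>. test_function \<phi> \<Longrightarrow> \<bar>pairing f ((deriv ^^ n) \<phi>)\<bar> \<le> M * L2_norm \<phi>"
  shows "deriv_in_L2 n f \<and> L2_norm (weak_deriv n f) \<le> M"
proof -
  have "pairing f ((deriv ^^ n) (\<lambda>x. a * \<phi> x + b * \<psi> x)) =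
      a * pairing f ((deriv ^^ n) \<phi>) + b * pairing f ((deriv ^^ n) \<psi>)"
    if "test_function \<phi>" "test_function \<psi>" for \<phi> \<psi> a b
    unfolding iterated_deriv_lincomb[OF that]
    by (rule pairing_lincomb[OF f that[THEN test_function_iterated_deriv]])
  from Riesz_test_functions[OF M this bound] obtain g
    where g: "in_L2 g" "L2_norm g \<le> M" "\<And>\<phi>. test_function \<phi> \<Longrightarrow> pairing g \<phi> = pairing f ((deriv ^^ n) \<phi>)"
    by blast
  define g' where "g' x = (-1) ^ n * g x" for x
  have g': "in_L2 g'"
    using in_L2_lincomb(1)[OF g(1) g(1), of "(-1) ^ n" 0] by (simp add: g'_def[abs_def])
  have "(g' x)\<^sup>2 = (g x)\<^sup>2" for x
    by (simp add: g'_def power_mult_distrib power_mult[symmetric] mult.commute[of n])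
  then have "L2_norm g' = L2_norm g" by (simp add: L2_norm_real)
  moreover have "(LINT x|lebesgue. g' x * \<phi> x) = (-1) ^ n * pairing g \<phi>" for \<phi>
    by (simp add: g'_def mult.assoc)
  then have "has_weak_deriv n f g'"
    unfolding has_weak_deriv_def using f in_L2_locally_integrable[OF g'] g(3)
    by (simp add: mult.assoc[symmetric] power_add[symmetric] mult_2[symmetric])
  ultimately show ?thesis
    using weak_deriv_in_L2[OF _ g'] g(2) by metis
qed

lemma weak_pairing_bound:
  assumes "deriv_in_L2 n f" "test_function \<psi>"
  shows "\<bar>pairing f ((deriv ^^ n) \<psi>)\<bar> \<le> L2_norm (weak_deriv n f) * L2_norm \<psi>"
proof -
  obtain g where "has_weak_deriv n f g" "in_L2 g" using assms(1) by (auto simp: deriv_in_L2_def)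
  note w = weak_deriv_in_L2[OF this]
  have "pairing f ((deriv ^^ n) \<psi>) = (-1) ^ n * pairing (weak_deriv n f) \<psi>"
    using w(2) assms(2) by (simp add: has_weak_deriv_def)
  then have "\<bar>pairing f ((deriv ^^ n) \<psi>)\<bar> = \<bar>pairing (weak_deriv n f) \<psi>\<bar>"
    by (simp add: abs_mult power_abs)
  then show ?thesis
    using L2_Cauchy_Schwarz[OF w(3) in_L2_test_function[OF assms(2)]] by simp
qed

lemma L2_norm_component:
  fixes F :: "real \<Rightarrow> 'b :: real_normed_vector"
  assumes "integrable lebesgue (\<lambda>x. (norm (F x))\<^sup>2)" "in_L2 f" "\<And>x. (f x)\<^sup>2 \<le> (norm (F x))\<^sup>2"
  shows "L2_norm f \<le> L2_norm F"
  unfolding L2_norm_def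
  using assms by (intro real_sqrt_le_mono integral_mono) (auto simp: in_L2_def)

lemma deriv_in_L2_locally_integrable: "deriv_in_L2 n f \<Longrightarrow> locally_integrable f"
  by (auto simp: deriv_in_L2_def has_weak_deriv_def)

lemma weak_deriv_in_L2': "deriv_in_L2 n f \<Longrightarrow> in_L2 (weak_deriv n f)"
  using weak_deriv_in_L2(3) by (auto simp: deriv_in_L2_def)

lemma pairing_cong_AE:
  assumes "AE x in lebesgue. f x = g x" "locally_integrable f" "locally_integrable g" "test_function \<phi>"
  shows "pairing f \<phi> = pairing g \<phi>"
proof (rule integral_cong_AE)
  show "AE x in lebesgue. f x * \<phi> x = g x * \<phi> x" using assms(1) by eventually_elim simp
qed (use integrable_pairing_test_function[OF assms(2,4)] integrable_pairing_test_function[OF assms(3,4)] in auto)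

text \<open>The solution formula for \<open>u\<close> contains \<open>\<gamma> \<langle>E\<^sub>0, \<partial>\<^sub>x\<^sup>2 S(t) \<phi>\<rangle>\<close>. One of the two derivatives is spent on
  \<open>E\<^sub>0\<close>, which is why \<open>\<partial>\<^sup>\<alpha>\<^sup>+\<^sup>1 E\<^sub>0\<close> enters; the other one is absorbed by the energy at the cost of a factor
  \<open>1 / sqrt \<gamma>\<close>.\<close>

lemma velocity_decay:
  assumes \<gamma>: "\<gamma> > 0" and sol: "solves_cauchy \<gamma> u E u0 E0" and t: "t \<ge> 0"
    and data: "deriv_in_L2 \<alpha> u0" "deriv_in_L2 \<alpha> E0" "deriv_in_L2 (\<alpha> + 1) E0"
  shows "deriv_in_L2 \<alpha> (u t) \<and> L2_norm (weak_deriv \<alpha> (u t)) \<le>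
    (4 + sqrt \<gamma> + 1 / sqrt \<gamma>) * exp (- t / 2) *
      L2_norm (\<lambda>x. (weak_deriv \<alpha> u0 x, weak_deriv \<alpha> E0 x, weak_deriv (\<alpha> + 1) E0 x))"
proof -
  define c where "c = sqrt \<gamma>"
  have c: "0 < c" "c * c = \<gamma>" using \<gamma> by (auto simp: c_def)
  define N where "N = L2_norm (\<lambda>x. (weak_deriv \<alpha> u0 x, weak_deriv \<alpha> E0 x, weak_deriv (\<alpha> + 1) E0 x))"
  note L2 = data[THEN weak_deriv_in_L2']
  have norm3: "(norm (x, y, z))\<^sup>2 = x\<^sup>2 + y\<^sup>2 + z\<^sup>2" for x y z :: real
    by (simp add: norm_Pair)
  have N: "L2_norm (weak_deriv \<alpha> u0) \<le> N" "L2_norm (weak_deriv \<alpha> E0) \<le> N"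
    "L2_norm (weak_deriv (\<alpha> + 1) E0) \<le> N" "0 \<le> N"
    unfolding N_def using L2
    by (intro L2_norm_component L2_norm_nonneg; auto simp: norm3 in_L2_def)+
  have loc: "locally_integrable (u 0)" "locally_integrable (E 0)" "locally_integrable (u t)"
    using sol t by (auto simp: solves_cauchy_def continuous_into_L1_loc_def)
  have initial: "pairing (u 0) \<psi> = pairing u0 \<psi>" "pairing (E 0) \<psi> = pairing E0 \<psi>" if "test_function \<psi>" for \<psi>
    using sol loc data[THEN deriv_in_L2_locally_integrable] that
    by (auto simp: solves_cauchy_def intro!: pairing_cong_AE)
  have "\<bar>pairing (u t) ((deriv ^^ \<alpha>) \<phi>)\<bar> \<le> ((4 + c) * exp (- t / 2) * N) * L2_norm \<phi>"
    if \<phi>: "test_function \<phi>" for \<phi>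
  proof -
    define S C S' where "S = sine_prop c \<phi> t" and "C = cosine_prop c \<phi> t" and "S' = sine_prop c (deriv \<phi>) t"
    have test: "test_function S" "test_function C" "test_function S'"
      using \<phi> c by (auto simp: S_def C_def S'_def intro!: sine_prop_test_function cosine_prop_test_function)
    have n: "L2_norm C \<le> L2_norm \<phi>" "c * L2_norm S' \<le> L2_norm \<phi>" "L2_norm S \<le> 2 * L2_norm \<phi>"
      using propagator_bounds[OF \<phi> c(1), of t] c(1) by (auto simp: S_def C_def S'_def field_simps)
    have comm: "sine_prop c ((deriv ^^ \<alpha>) \<phi>) t = (deriv ^^ \<alpha>) S" "cosine_prop c ((deriv ^^ \<alpha>) \<phi>) t = (deriv ^^ \<alpha>) C"
      using iterated_deriv_sine_prop[OF \<phi>] iterated_deriv_cosine_prop[OF \<phi>] c by (auto simp: S_def C_def)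
    have comm2: "sine_prop c ((deriv ^^ 2) ((deriv ^^ \<alpha>) \<phi>)) t = (deriv ^^ (\<alpha> + 1)) S'"
    proof -
      have "(deriv ^^ 2) ((deriv ^^ \<alpha>) \<phi>) = (deriv ^^ (\<alpha> + 1)) (deriv \<phi>)"
        by (simp add: numeral_2_eq_2 funpow_swap1)
      then show ?thesis
        using iterated_deriv_sine_prop[OF test_function_deriv[OF \<phi>], of "\<alpha> + 1"] by (simp only: S'_def)
    qed
    have "\<bar>exp (t / 2) * pairing (u t) ((deriv ^^ \<alpha>) \<phi>)\<bar> =
      \<bar>\<gamma> * pairing E0 ((deriv ^^ (\<alpha> + 1)) S') - pairing E0 ((deriv ^^ \<alpha>) S)
        + pairing u0 ((deriv ^^ \<alpha>) C) - 1/2 * pairing u0 ((deriv ^^ \<alpha>) S)\<bar>"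
      using velocity_at_time_by_duality[OF \<gamma> sol test_function_iterated_deriv[OF \<phi>, of \<alpha>] t]
      by (simp only: c_def[symmetric] comm comm2 initial test test_function_iterated_deriv)
    also have "\<dots> \<le> \<gamma> * \<bar>pairing E0 ((deriv ^^ (\<alpha> + 1)) S')\<bar> + \<bar>pairing E0 ((deriv ^^ \<alpha>) S)\<bar>
        + \<bar>pairing u0 ((deriv ^^ \<alpha>) C)\<bar> + 1/2 * \<bar>pairing u0 ((deriv ^^ \<alpha>) S)\<bar>"
    proof -
      have "\<bar>\<gamma> * p - q + r - 1/2 * s\<bar> \<le> \<gamma> * \<bar>p\<bar> + \<bar>q\<bar> + \<bar>r\<bar> + 1/2 * \<bar>s\<bar>" for p q r s :: real
      proof -
        have "\<bar>\<gamma> * p\<bar> = \<gamma> * \<bar>p\<bar>" using \<gamma> by (simp add: abs_mult)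
        then show ?thesis by linarith
      qed
      then show ?thesis .
    qed
    also have "\<dots> \<le> \<gamma> * (N * L2_norm S') + N * L2_norm S + N * L2_norm C + 1/2 * (N * L2_norm S)"
    proof -
      have "\<bar>pairing E0 ((deriv ^^ (\<alpha> + 1)) S')\<bar> \<le> N * L2_norm S'"
        "\<bar>pairing E0 ((deriv ^^ \<alpha>) S)\<bar> \<le> N * L2_norm S"
        "\<bar>pairing u0 ((deriv ^^ \<alpha>) C)\<bar> \<le> N * L2_norm C"
        "\<bar>pairing u0 ((deriv ^^ \<alpha>) S)\<bar> \<le> N * L2_norm S"
        using N data test
        by (auto intro!: order_trans[OF weak_pairing_bound] mult_right_mono L2_norm_nonneg simp del: funpow.simps)
      then show ?thesis using \<gamma> by (intro add_mono mult_left_mono) auto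
    qed
    also have "\<dots> = N * (c * (c * L2_norm S') + L2_norm C + 3/2 * L2_norm S)"
      by (simp add: c(2)[symmetric] algebra_simps)
    also have "\<dots> \<le> N * (c * L2_norm \<phi> + L2_norm \<phi> + 3/2 * (2 * L2_norm \<phi>))"
      using n N(4) c(1) by (intro mult_left_mono add_mono) auto
    also have "\<dots> = (4 + c) * N * L2_norm \<phi>" by (simp add: algebra_simps)
    finally have "\<bar>exp (t / 2) * pairing (u t) ((deriv ^^ \<alpha>) \<phi>)\<bar> \<le> (4 + c) * N * L2_norm \<phi>" .
    then show ?thesis by (simp add: abs_mult exp_minus field_simps)
  qed
  from weak_deriv_by_duality[OF loc(3) _ this]
  have d: "deriv_in_L2 \<alpha> (u t)" "L2_norm (weak_deriv \<alpha> (u t)) \<le> (4 + c) * exp (- t / 2) * N"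
    using N(4) c(1) by auto
  have "(4 + c) * exp (- t / 2) * N \<le> (4 + c + 1 / c) * exp (- t / 2) * N"
    using N(4) c(1) by (intro mult_right_mono) auto
  from d(1) order_trans[OF d(2) this] show ?thesis unfolding N_def c_def by (rule conjI)
qed

text \<open>For \<open>\<alpha> > 0\<close> one of the \<open>\<alpha>\<close> derivatives in \<open>\<langle>u\<^sub>0, \<partial>\<^sup>\<alpha> S(t) \<phi>\<rangle>\<close> is left on the propagator and controlled by
  the energy, so that \<open>u\<^sub>0\<close> receives only \<open>\<alpha> - 1\<close> of them. For \<open>\<alpha> = 0\<close> the bound on \<open>S(t) \<phi>\<close> itself is
  used, which comes from the mass term of the equation.\<close>

lemma position_decay:
  assumes \<gamma>: "\<gamma> > 0" and sol: "solves_cauchy \<gamma> u E u0 E0" and t: "t \<ge> 0"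
    and data: "deriv_in_L2 (\<alpha> - 1) u0" "deriv_in_L2 \<alpha> E0"
  shows "deriv_in_L2 \<alpha> (E t) \<and> L2_norm (weak_deriv \<alpha> (E t)) \<le>
    (4 + sqrt \<gamma> + 1 / sqrt \<gamma>) * exp (- t / 2) *
      L2_norm (\<lambda>x. (weak_deriv (\<alpha> - 1) u0 x, weak_deriv \<alpha> E0 x))"
proof -
  define c where "c = sqrt \<gamma>"
  have c: "0 < c" using \<gamma> by (auto simp: c_def)
  define N where "N = L2_norm (\<lambda>x. (weak_deriv (\<alpha> - 1) u0 x, weak_deriv \<alpha> E0 x))"
  note L2 = data[THEN weak_deriv_in_L2']
  have norm2: "(norm (x, y))\<^sup>2 = x\<^sup>2 + y\<^sup>2" for x y :: real
    by (simp add: norm_Pair)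
  have N: "L2_norm (weak_deriv (\<alpha> - 1) u0) \<le> N" "L2_norm (weak_deriv \<alpha> E0) \<le> N" "0 \<le> N"
    unfolding N_def using L2
    by (intro L2_norm_component L2_norm_nonneg; auto simp: norm2 in_L2_def)+
  have loc: "locally_integrable (u 0)" "locally_integrable (E 0)" "locally_integrable (E t)"
    using sol t by (auto simp: solves_cauchy_def continuous_into_L1_loc_def)
  have initial: "pairing (u 0) \<psi> = pairing u0 \<psi>" "pairing (E 0) \<psi> = pairing E0 \<psi>" if "test_function \<psi>" for \<psi>
    using sol loc data[THEN deriv_in_L2_locally_integrable] that
    by (auto simp: solves_cauchy_def intro!: pairing_cong_AE)
  have "\<bar>pairing (E t) ((deriv ^^ \<alpha>) \<phi>)\<bar> \<le> ((4 + 1 / c) * exp (- t / 2) * N) * L2_norm \<phi>"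
    if \<phi>: "test_function \<phi>" for \<phi>
  proof -
    define S C where "S = sine_prop c \<phi> t" and "C = cosine_prop c \<phi> t"
    have test: "test_function S" "test_function C"
      using \<phi> c sine_prop_test_function cosine_prop_test_function by (auto simp: S_def C_def)
    note n = propagator_bounds[OF \<phi> c, of t, folded S_def C_def]
    have comm: "sine_prop c ((deriv ^^ \<alpha>) \<phi>) t = (deriv ^^ \<alpha>) S" "cosine_prop c ((deriv ^^ \<alpha>) \<phi>) t = (deriv ^^ \<alpha>) C"
      using iterated_deriv_sine_prop[OF \<phi>] iterated_deriv_cosine_prop[OF \<phi>] c by (auto simp: S_def C_def)
    have u0: "\<bar>pairing u0 ((deriv ^^ \<alpha>) S)\<bar> \<le> N * ((2 + 1 / c) * L2_norm \<phi>)"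
    proof (cases \<alpha>)
      case 0
      have "\<bar>pairing u0 ((deriv ^^ 0) S)\<bar> \<le> N * L2_norm S"
        using weak_pairing_bound[of 0 u0 S] data(1) test(1) N(1) 0 L2_norm_nonneg[of S]
        by (auto intro: order_trans mult_right_mono simp del: funpow.simps)
      also have "\<dots> \<le> N * ((2 + 1 / c) * L2_norm \<phi>)"
        using n(3) c L2_norm_nonneg[of \<phi>] N(3)
        by (intro mult_left_mono order_trans[OF n(3)] mult_right_mono) auto
      finally show ?thesis using 0 by simp
    next
      case (Suc k)
      define S' where "S' = sine_prop c (deriv \<phi>) t"
      have S': "test_function S'"
        using \<phi> c by (auto simp: S'_def intro!: sine_prop_test_function)
      have "deriv S = S'" using iterated_deriv_sine_prop[OF \<phi>, of 1 c t] by (simp add: S_def S'_def)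
      then have "(deriv ^^ \<alpha>) S = (deriv ^^ k) S'" by (simp add: Suc funpow_swap1)
      then have "\<bar>pairing u0 ((deriv ^^ \<alpha>) S)\<bar> \<le> N * L2_norm S'"
        using weak_pairing_bound[of k u0 S'] data(1) S' N(1) Suc L2_norm_nonneg[of S']
        by (auto intro: order_trans mult_right_mono simp del: funpow.simps)
      also have "\<dots> \<le> N * ((2 + 1 / c) * L2_norm \<phi>)"
      proof (rule mult_left_mono)
        have "L2_norm S' \<le> 1 / c * L2_norm \<phi>" using n(2) by (simp add: S'_def)
        also have "\<dots> \<le> (2 + 1 / c) * L2_norm \<phi>" by (intro mult_right_mono) (auto simp: L2_norm_nonneg)
        finally show "L2_norm S' \<le> (2 + 1 / c) * L2_norm \<phi>" .
      qed (rule N(3))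
      finally show ?thesis .
    qed
    have "\<bar>exp (t / 2) * pairing (E t) ((deriv ^^ \<alpha>) \<phi>)\<bar> =
      \<bar>pairing E0 ((deriv ^^ \<alpha>) C) + 1/2 * pairing E0 ((deriv ^^ \<alpha>) S) + pairing u0 ((deriv ^^ \<alpha>) S)\<bar>"
      using solution_at_time_by_duality[OF \<gamma> sol test_function_iterated_deriv[OF \<phi>, of \<alpha>] t]
      by (simp only: c_def[symmetric] comm initial test test_function_iterated_deriv)
    also have "\<dots> \<le> \<bar>pairing E0 ((deriv ^^ \<alpha>) C)\<bar> + 1/2 * \<bar>pairing E0 ((deriv ^^ \<alpha>) S)\<bar>
        + \<bar>pairing u0 ((deriv ^^ \<alpha>) S)\<bar>" by linarith
    also have "\<dots> \<le> N * L2_norm C + 1/2 * (N * L2_norm S) + N * ((2 + 1 / c) * L2_norm \<phi>)"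
    proof -
      have "\<bar>pairing E0 ((deriv ^^ \<alpha>) S)\<bar> \<le> N * L2_norm S" "\<bar>pairing E0 ((deriv ^^ \<alpha>) C)\<bar> \<le> N * L2_norm C"
        using N data test
        by (auto intro!: order_trans[OF weak_pairing_bound] mult_right_mono L2_norm_nonneg simp del: funpow.simps)
      then show ?thesis using u0 by (intro add_mono mult_left_mono) auto
    qed
    also have "\<dots> = N * (L2_norm C + 1/2 * L2_norm S + (2 + 1 / c) * L2_norm \<phi>)"
      by (simp add: algebra_simps)
    also have "\<dots> \<le> N * (L2_norm \<phi> + 1/2 * (2 * L2_norm \<phi>) + (2 + 1 / c) * L2_norm \<phi>)"
      using n N(3) c by (intro mult_left_mono add_mono) auto
    also have "\<dots> = (4 + 1 / c) * N * L2_norm \<phi>" by (simp add: algebra_simps)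
    finally have "\<bar>exp (t / 2) * pairing (E t) ((deriv ^^ \<alpha>) \<phi>)\<bar> \<le> (4 + 1 / c) * N * L2_norm \<phi>" .
    then have "exp (- t / 2) * \<bar>exp (t / 2) * pairing (E t) ((deriv ^^ \<alpha>) \<phi>)\<bar> \<le>
        exp (- t / 2) * ((4 + 1 / c) * N * L2_norm \<phi>)"
      by (rule mult_left_mono) simp
    moreover have "exp (- t / 2) * \<bar>exp (t / 2) * pairing (E t) ((deriv ^^ \<alpha>) \<phi>)\<bar> = \<bar>pairing (E t) ((deriv ^^ \<alpha>) \<phi>)\<bar>"
      by (simp add: abs_mult exp_minus)
    ultimately show ?thesis by (simp only: mult_ac)
  qed
  from weak_deriv_by_duality[OF loc(3) _ this]
  have d: "deriv_in_L2 \<alpha> (E t)" "L2_norm (weak_deriv \<alpha> (E t)) \<le> (4 + 1 / c) * exp (- t / 2) * N"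
    using N(3) c by auto
  have "(4 + 1 / c) * exp (- t / 2) * N \<le> (4 + c + 1 / c) * exp (- t / 2) * N"
    using N(3) c by (intro mult_right_mono) auto
  from d(1) order_trans[OF d(2) this] show ?thesis unfolding N_def c_def by (rule conjI)
qed

theorem corollary2p11:
  fixes \<gamma> :: real
  assumes "\<gamma> > 0"
  shows "\<forall>\<alpha>::nat. \<exists>C>0. \<forall>(u :: real \<Rightarrow> real \<Rightarrow> real) (E :: real \<Rightarrow> real \<Rightarrow> real)
           (u0 :: real \<Rightarrow> real) (E0 :: real \<Rightarrow> real).
    solves_cauchy \<gamma> u E u0 E0 \<longrightarrow>
      (deriv_in_L2 \<alpha> u0 \<and> deriv_in_L2 \<alpha> E0 \<and> deriv_in_L2 (\<alpha> + 1) E0 \<longrightarrow>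
        (\<forall>t\<ge>0. deriv_in_L2 \<alpha> (u t) \<and>
          L2_norm (weak_deriv \<alpha> (u t)) \<le> C * exp (- t / 2) *
            L2_norm (\<lambda>x. (weak_deriv \<alpha> u0 x, weak_deriv \<alpha> E0 x, weak_deriv (\<alpha> + 1) E0 x)))) \<and>
      (deriv_in_L2 (nat (max 0 (int \<alpha> - 1))) u0 \<and> deriv_in_L2 \<alpha> E0 \<longrightarrow>
        (\<forall>t\<ge>0. deriv_in_L2 \<alpha> (E t) \<and>
          L2_norm (weak_deriv \<alpha> (E t)) \<le> C * exp (- t / 2) *
            L2_norm (\<lambda>x. (weak_deriv (nat (max 0 (int \<alpha> - 1))) u0 x, weak_deriv \<alpha> E0 x))))"
proof (intro allI exI[of _ "4 + sqrt \<gamma> + 1 / sqrt \<gamma>"] conjI impI)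
  show "0 < 4 + sqrt \<gamma> + 1 / sqrt \<gamma>"
    using assms by (intro add_pos_pos) auto
next
  fix \<alpha> u E u0 E0 t
  have pred: "nat (max 0 (int \<alpha> - 1)) = \<alpha> - 1" by simp
  assume sol: "solves_cauchy \<gamma> u E u0 E0" and t: "0 \<le> (t :: real)"
  {
    assume "deriv_in_L2 \<alpha> u0 \<and> deriv_in_L2 \<alpha> E0 \<and> deriv_in_L2 (\<alpha> + 1) E0"
    with velocity_decay[OF assms sol t, of \<alpha>]
    show "deriv_in_L2 \<alpha> (u t)"
      "L2_norm (weak_deriv \<alpha> (u t)) \<le> (4 + sqrt \<gamma> + 1 / sqrt \<gamma>) * exp (- t / 2) *
            L2_norm (\<lambda>x. (weak_deriv \<alpha> u0 x, weak_deriv \<alpha> E0 x, weak_deriv (\<alpha> + 1) E0 x))"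
      by blast+
  next
    assume "deriv_in_L2 (nat (max 0 (int \<alpha> - 1))) u0 \<and> deriv_in_L2 \<alpha> E0"
    with position_decay[OF assms sol t, of \<alpha>]
    show "deriv_in_L2 \<alpha> (E t)"
      "L2_norm (weak_deriv \<alpha> (E t)) \<le> (4 + sqrt \<gamma> + 1 / sqrt \<gamma>) * exp (- t / 2) *
            L2_norm (\<lambda>x. (weak_deriv (nat (max 0 (int \<alpha> - 1))) u0 x, weak_deriv \<alpha> E0 x))"
      unfolding pred by blast+
  }
qed

end
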